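(* Consider the stochastic algorithm $\theta_{n+1}=\theta_n+\alpha F_n$ on $\Theta$ with a deterministic and time-independent step-size $\alpha$, and let $\Psi:\Theta\to\mathbb{R}_{\ge0}$. Given $\theta_n\in\Theta$ and $N\in\mathbb{N}_+$, let $\Theta_{\alpha,N}(\theta_n)$ and $\tilde\Theta_{N\alpha}(\theta_n)$ be subsets of $\Theta$ in which $\{\theta_{n+k}\}_{k=0}^{N}$ and $\varphi(t;\theta_n)$ for $t\in[0,N\alpha]$, respectively, almost surely stay. Let $U\subseteq\Theta$. Assume that for any $\theta_n\in U$ and any $N\in\mathbb{N}_+$: (P1) there exists a positive definite symmetric matrix $Q=Q_{\alpha,N}(\theta_n)$ satisfying $\sup_{\|h\|=1}|D^+_h\Psi(\theta)|\,\|h\|_{Q^{-1}}\le 1$ for all $\theta$ in the convex hull of $\Theta_{\alpha,N}(\theta_n)\cup\tilde\Theta_{N\alpha}(\theta_n)$ (if $\Psi$ is differentiable, this condition can be replaced with $\|\nabla\Psi(\theta)\|_{Q^{-1}}\le 1$); (P2) there exists a function $L_{\alpha,N}(\theta,\theta_n)>0$ such that $\|F(\theta)-F(\theta')\|_{Q}\le L_{\alpha,N}(\theta,\theta_n)\|\theta-\theta'\|_{Q}$ for any $\theta\in\Theta_{\alpha,N}(\theta_n)$ and $\theta'\in\tilde\Theta_{N\alpha}(\theta_n)$, and there exists a function $\Delta_L$, independent of $\theta_n\in U$ and nondecreasing with respect to both arguments, satisfying $$\mathbb{E}_n\Big[\prod_{k=0}^{N-1}\big(1+\alpha L_{\alpha,N}(\theta_{n+k},\theta_n)\big)^2\Big]^{1/2}\le\Delta_L(\alpha,N\alpha);$$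 (P3) there exists a function $\Delta_{\tilde L}$, independent of $\theta_n\in U$ and nondecreasing with respect to both arguments, satisfying $\|F(\theta)-F(\theta')\|_{Q}\le\Delta_{\tilde L}(\alpha,N\alpha)\|\theta-\theta'\|_{Q}$ for any $\theta,\theta'\in\tilde\Theta_{N\alpha}(\theta_n)$; (P4) there is a function $R$ satisfying $\mathbb{E}[\|F_i\|_{Q}^2\mid\theta_i=\theta]^{1/2}\le R(\theta)$ for any $\theta\in\Theta_{\alpha,N}(\theta_n)\cup\tilde\Theta_{N\alpha}(\theta_n)$ and $R(\theta_a)^2\le K_1^2\|\theta_a-\theta_b\|_{Q}^2+K_2^2R(\theta_b)^2$ for any $\theta_a,\theta_b\in\Theta_{\alpha,N}(\theta_n)\cup\tilde\Theta_{N\alpha}(\theta_n)$, where $K_1,K_2\ge0$ are constants independent of $\theta_n\in U$. Then, for any $\theta_n\in U$ and $N\in\mathbb{N}_+$, $\varphi(\cdot;\theta_n):[0,N\alpha]\to\tilde\Theta_{N\alpha}(\theta_n)$ is a unique solution satisfying $\varphi(t;\theta_n)=\theta_n+\int_0^tF(\varphi(\tau;\theta_n))\,\mathrm{d}\tau$, and $$\sup_{0\le k\le N}\mathbb{E}_n\big[|\Psi(\theta_{n+k})-\Psi(\varphi(k\alpha;\theta_n))|\big]\le(C_1+C_2)\,\Delta_L(\alpha,N\alpha),$$ where $$C_1=\sum_{i=0}^{N-1}\Delta_{\tilde L}(\alpha,N\alpha)\int_{i\alpha}^{(i+1)\alpha}\big((i+1)\alpha-t\big)R(\varphi(t;\theta_n))\,\mathrm{d}t,$$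 $$C_2=\big(1+(K_1N\alpha)^2\exp(2K_1N\alpha)\big)^{1/2}K_2\,(N\alpha^2)^{1/2}R(\theta_n).$$
   Context: Notation: $\mathbb{N}_+$ is the set of positive integers, $\mathbb{R}_{\ge0}=[0,\infty)$; $\|\cdot\|$ is the Euclidean norm; for a positive definite symmetric matrix $Q$, $\|\theta\|_Q=(\theta^{\mathrm T}Q\theta)^{1/2}$; $D^+_{h}\Psi(\theta)=\limsup_{s\downarrow0}[\Psi(\theta+sh)-\Psi(\theta)]/s$ is the upper Dini directional derivative. Setting: $\Theta\subseteq\mathbb{R}^{D}$ for a positive integer $D$. The stochastic algorithm is $\theta_{n+1}=\theta_n+\alpha F_n$, where the $F_n$ are random vectors in $\mathbb{R}^{D}$. Let $\{\mathcal{F}_n\}$ be the natural filtration associated with $\{\theta_n\}$ and $\mathbb{E}_n=\mathbb{E}[\cdot\mid\mathcal{F}_n]$. The dependency of $F_n$ on the past is only through $\theta_n$, and the conditional distribution of $F_n$ given $\theta_n=\theta$ does not depend on $n$. The mean field $F(\theta)=\mathbb{E}[F_n\mid\theta_n=\theta]$ is assumed to be well defined, and $\varphi(\cdot;\theta)$ denotes the flow of $\mathrm{d}\theta/\mathrm{d}t=F(\theta)$, i.e. the absolutely continuous solution of $\varphi(t;\theta)=\theta+\int_0^tF(\varphi(\tau;\theta))\,\mathrm{d}\tau$. Standing assumption: the step-size $\alpha>0$ is small enough that $\{\theta_n\}$ never leaves $\Theta$. *)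

theory Defs
  imports "HOL-Probability.Probability"
begin

definition natural_filtration :: "'w measure \<Rightarrow> (nat \<Rightarrow> 'w \<Rightarrow> 'a::topological_space) \<Rightarrow> nat \<Rightarrow> 'w measure"
  where "natural_filtration M X m =
    sigma (space M) {X i -` A \<inter> space M | i A. i \<le> m \<and> A \<in> sets borel}"

(* K \<theta> is the conditional distribution of the m-th random vector G m given that the m-th iterate is
   \<theta>.  It is one kernel for all m, and it is also the conditional distribution given the whole past.
   K is total only for convenience: its values outside \<Theta> are never used, and a kernel on
   \<Theta> always extends to a measurable total one. *)
locale stochastic_algorithm = prob_space M
  for M :: "'w measure" +
  fixes \<Theta> :: "(real ^ 'd) set"
    and \<alpha> :: real
    and X G :: "nat \<Rightarrow> 'w \<Rightarrow> real ^ 'd"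
    and K :: "real ^ 'd \<Rightarrow> (real ^ 'd) measure"
  assumes step_size_pos: "0 < \<alpha>"
    and X_measurable: "X m \<in> borel_measurable M"
    and G_measurable: "G m \<in> borel_measurable M"
    and update: "\<omega> \<in> space M \<Longrightarrow> X (Suc m) \<omega> = X m \<omega> + \<alpha> *\<^sub>R G m \<omega>"
    and never_leaves: "\<omega> \<in> space M \<Longrightarrow> X m \<omega> \<in> \<Theta>"
    and kernel: "K \<in> borel \<rightarrow>\<^sub>M prob_algebra borel"
    and cond_distribution: "A \<in> sets borel \<Longrightarrow>
      AE \<omega> in M. real_cond_exp M (natural_filtration M X m) (indicator (G m -` A \<inter> space M)) \<omega>
        = measure (K (X m \<omega>)) A"
    and mean_field_exists: "\<theta> \<in> \<Theta> \<Longrightarrow> integrable (K \<theta>) (\<lambda>x. x)"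

definition mean_field :: "(real ^ 'd \<Rightarrow> (real ^ 'd) measure) \<Rightarrow> real ^ 'd \<Rightarrow> real ^ 'd"
  where "mean_field K \<theta> = (LINT x|K \<theta>. x)"

(* y : [0,b] \<rightarrow> A is a solution of y' = F(y), y(0) = \<theta>.  The integral equation with an absolutely
   integrable integrand is exactly absolute continuity together with the equation almost everywhere. *)
definition flow_solution ::
    "(real ^ 'd \<Rightarrow> real ^ 'd) \<Rightarrow> (real ^ 'd) set \<Rightarrow> real ^ 'd \<Rightarrow> real \<Rightarrow> (real \<Rightarrow> real ^ 'd) \<Rightarrow> bool"
  where "flow_solution F A \<theta> b y \<longleftrightarrow>
    (\<forall>t\<in>{0..b}. y t \<in> A) \<and>
    (\<lambda>\<tau>. F (y \<tau>)) absolutely_integrable_on {0..b} \<and>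
    (\<forall>t\<in>{0..b}. y t = \<theta> + integral {0..t} (\<lambda>\<tau>. F (y \<tau>)))"

definition pos_def_sym :: "real ^ 'd ^ 'd \<Rightarrow> bool"
  where "pos_def_sym Q \<longleftrightarrow> transpose Q = Q \<and> (\<forall>x. x \<noteq> 0 \<longrightarrow> 0 < x \<bullet> (Q *v x))"

definition qnorm :: "real ^ 'd ^ 'd \<Rightarrow> real ^ 'd \<Rightarrow> real"
  where "qnorm Q x = sqrt (x \<bullet> (Q *v x))"

definition upper_dini :: "('a::real_normed_vector \<Rightarrow> real) \<Rightarrow> 'a \<Rightarrow> 'a \<Rightarrow> ereal"
  where "upper_dini \<Psi> \<theta> h = Limsup (at_right 0) (\<lambda>s. ereal ((\<Psi> (\<theta> + s *\<^sub>R h) - \<Psi> \<theta>) / s))"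

(* Square root of a possibly infinite expectation; valued in ereal so that "esqrt e \<le> ereal c" keeps
   its meaning (in particular forces c \<ge> 0), whereas ennreal would truncate a negative c to 0. *)
definition esqrt :: "ennreal \<Rightarrow> ereal"
  where "esqrt e = (if e = \<infinity> then \<infinity> else ereal (sqrt (enn2real e)))"

definition nondecreasing2 :: "(real \<Rightarrow> real \<Rightarrow> real) \<Rightarrow> bool"
  where "nondecreasing2 \<Delta> \<longleftrightarrow>
    (\<forall>a a' t t'. 0 < a \<and> a \<le> a' \<and> 0 < t \<and> t \<le> t' \<longrightarrow> \<Delta> a t \<le> \<Delta> a' t')"

definition C1 :: "(real \<Rightarrow> real \<Rightarrow> real) \<Rightarrow> real \<Rightarrow> nat \<Rightarrow> (real ^ 'd \<Rightarrow> real) \<Rightarrow> (real \<Rightarrow> real ^ 'd) \<Rightarrow> real"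
  where "C1 \<Delta> \<alpha> N R y =
    (\<Sum>i<N. \<Delta> \<alpha> (real N * \<alpha>) *
      integral {real i * \<alpha>..(real i + 1) * \<alpha>} (\<lambda>t. ((real i + 1) * \<alpha> - t) * R (y t)))"

definition C2 :: "real \<Rightarrow> real \<Rightarrow> real \<Rightarrow> nat \<Rightarrow> (real ^ 'd \<Rightarrow> real) \<Rightarrow> real ^ 'd \<Rightarrow> real"
  where "C2 K\<^sub>1 K\<^sub>2 \<alpha> N R \<theta> =
    sqrt (1 + (K\<^sub>1 * real N * \<alpha>)\<^sup>2 * exp (2 * K\<^sub>1 * real N * \<alpha>))
      * K\<^sub>2 * sqrt (real N * \<alpha>\<^sup>2) * R \<theta>"

end

theory Submission
  imports Defs
begin

text \<open>Write \<open>e\<^sub>k = \<theta>\<^sub>n\<^sub>+\<^sub>k - \<phi>(k\<alpha>)\<close> for the error, measured in the norm of \<open>Q\<close>, and \<open>P\<^sub>k\<close> for the product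
  of the factors \<open>1 + \<alpha> L\<close> at the iterates before time \<open>k\<close>. One step of the algorithm changes the error
  by the difference of the mean field at the iterate and at the flow, which multiplies its norm by at
  most \<open>1 + \<alpha> L\<close>; by the defect of one Euler step along the flow; and by \<open>\<alpha>\<close> times a noise term that
  is centred given the past. The idea is to follow \<open>u\<^sub>k\<close>, the root mean square of \<open>e\<^sub>k / P\<^sub>k\<close>. Since
  \<open>P\<^sub>k\<^sub>+\<^sub>1\<close> is known before the noise of step \<open>k\<close> is drawn and the noise is orthogonal to the past,
  \<open>u\<^sub>k\<^sub>+\<^sub>1\<^sup>2 \<le> (u\<^sub>k + \<delta>\<^sub>k)\<^sup>2 + \<alpha>\<^sup>2 E[R(\<theta>\<^sub>n\<^sub>+\<^sub>k)\<^sup>2]\<close>, where \<open>\<delta>\<^sub>k\<close> is the defect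
  (lemma \<open>one_step_weighted_error\<close>). Hence defects add up linearly, to \<open>C\<^sub>1\<close>, and noise adds up in
  squares, to \<open>C\<^sub>2\<close> (lemma \<open>weighted_error_second_moment\<close>). A pathwise discrete Gronwall inequality
  would instead need the maximum of the noise martingale over time, at the price of a constant from a
  maximal inequality. The Cauchy-Schwarz inequality applied to \<open>e\<^sub>k = (e\<^sub>k / P\<^sub>k) P\<^sub>k\<close> now gives
  \<open>E \<parallel>e\<^sub>k\<parallel> \<le> (C\<^sub>1 + C\<^sub>2) \<Delta>\<^sub>L\<close> (lemma \<open>mean_error_le\<close>).

  Two further ingredients surround this estimate. The bound on the derivative of \<open>\<Psi>\<close> makes \<open>\<Psi>\<close>
  one-Lipschitz for the norm of \<open>Q\<close> on the convex hull (lemma \<open>qnorm_Lipschitz_of_derivative_bound\<close>),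
  so that \<open>E \<parallel>e\<^sub>k\<parallel>\<close> bounds the mean difference of the values of \<open>\<Psi>\<close>. And since \<open>Q\<close> and \<open>R\<close> may depend
  on \<open>\<theta>\<^sub>n\<close> in a non-measurable way, the estimate is made for the Markov chain started at a fixed
  point; the Markov property (lemma \<open>nn_cond_exp_path_state\<close>) identifies conditional expectations
  given the past with integrals against the law of that chain.\<close>

section \<open>The norm of a positive definite matrix\<close>

lemma quadratic_form_commute:
  assumes "pos_def_sym Q"
  shows "x \<bullet> (Q *v y) = y \<bullet> (Q *v x)"
  using assms unfolding pos_def_sym_def
  by (metis dot_lmul_matrix inner_commute vector_transpose_matrix)

lemma quadratic_form_nonneg:
  assumes "pos_def_sym Q"
  shows "0 \<le> x \<bullet> (Q *v x)"
  using assms unfolding pos_def_sym_def by (cases "x = 0") (auto intro: less_imp_le)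

lemma qnorm_nonneg: "pos_def_sym Q \<Longrightarrow> 0 \<le> qnorm Q x"
  by (simp add: qnorm_def quadratic_form_nonneg)

lemma qnorm_power2: "pos_def_sym Q \<Longrightarrow> (qnorm Q x)\<^sup>2 = x \<bullet> (Q *v x)"
  by (simp add: qnorm_def quadratic_form_nonneg)

lemma qnorm_zero [simp]: "qnorm Q 0 = 0"
  by (simp add: qnorm_def)

lemma qnorm_pos: "pos_def_sym Q \<Longrightarrow> x \<noteq> 0 \<Longrightarrow> 0 < qnorm Q x"
  by (simp add: qnorm_def pos_def_sym_def)

lemma qnorm_scaleR: "qnorm Q (c *\<^sub>R x) = \<bar>c\<bar> * qnorm Q x"
proof -
  have "(c *\<^sub>R x) \<bullet> (Q *v (c *\<^sub>R x)) = c\<^sup>2 * (x \<bullet> (Q *v x))"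
    by (simp add: matrix_vector_mult_scaleR power2_eq_square)
  then show ?thesis by (simp add: qnorm_def real_sqrt_mult)
qed

lemma qnorm_minus: "qnorm Q (- x) = qnorm Q x"
  using qnorm_scaleR[of Q "-1" x] by simp

lemma qnorm_minus_commute: "qnorm Q (x - y) = qnorm Q (y - x)"
  by (metis minus_diff_eq qnorm_minus)

lemma qnorm_add_power2:
  assumes "pos_def_sym Q"
  shows "(qnorm Q (x + y))\<^sup>2 = (qnorm Q x)\<^sup>2 + 2 * (y \<bullet> (Q *v x)) + (qnorm Q y)\<^sup>2"
  using quadratic_form_commute[OF assms, of x y]
  by (simp add: qnorm_power2[OF assms] matrix_vector_right_distrib inner_add_left inner_add_right)

lemma qnorm_Cauchy_Schwarz:
  assumes "pos_def_sym Q"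
  shows "\<bar>x \<bullet> (Q *v y)\<bar> \<le> qnorm Q x * qnorm Q y"
proof (cases "y = 0")
  case False
  define b where "b = qnorm Q y"
  define c where "c = x \<bullet> (Q *v y)"
  have b: "0 < b" using qnorm_pos[OF assms False] by (simp add: b_def)
  have "0 \<le> (qnorm Q (x + (- c / b\<^sup>2) *\<^sub>R y))\<^sup>2" by simp
  also have "\<dots> = (qnorm Q x)\<^sup>2 + 2 * ((- c / b\<^sup>2) * c) + (c / b\<^sup>2)\<^sup>2 * b\<^sup>2"
    unfolding qnorm_add_power2[OF assms] qnorm_scaleR c_def b_def
    using quadratic_form_commute[OF assms, of x y]
    by (simp add: power_mult_distrib power_divide)
  also have "\<dots> = (qnorm Q x)\<^sup>2 - c\<^sup>2 / b\<^sup>2"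
    using b by (simp add: field_simps power2_eq_square)
  finally have "c\<^sup>2 \<le> (qnorm Q x * b)\<^sup>2"
    using b by (simp add: field_simps power_mult_distrib)
  then show ?thesis
    using b qnorm_nonneg[OF assms, of x] by (simp add: abs_le_square_iff[symmetric] b_def c_def)
qed simp

lemma qnorm_triangle:
  assumes "pos_def_sym Q"
  shows "qnorm Q (x + y) \<le> qnorm Q x + qnorm Q y"
proof (rule power2_le_imp_le)
  have "y \<bullet> (Q *v x) \<le> qnorm Q x * qnorm Q y"
    using qnorm_Cauchy_Schwarz[OF assms, of y x] by (simp add: mult.commute)
  then show "(qnorm Q (x + y))\<^sup>2 \<le> (qnorm Q x + qnorm Q y)\<^sup>2"
    unfolding qnorm_add_power2[OF assms] by (simp add: power2_sum)
qed (simp add: qnorm_nonneg[OF assms])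

lemma qnorm_le_of_form_le:
  assumes "pos_def_sym Q" and "v \<bullet> (Q *v v) \<le> c * qnorm Q v"
    and "0 \<le> c"
  shows "qnorm Q v \<le> c"
proof (cases "qnorm Q v = 0")
  case False
  then have "0 < qnorm Q v" using qnorm_nonneg[OF assms(1), of v] by simp
  then show ?thesis
    using assms(2) by (simp add: qnorm_power2[OF assms(1), symmetric] power2_eq_square)
qed (simp add: assms(3))

lemma continuous_on_qnorm [continuous_intros]:
  "continuous_on A f \<Longrightarrow> continuous_on A (\<lambda>x. qnorm Q (f x))"
  unfolding qnorm_def
  by (intro continuous_intros bounded_linear.continuous_on[OF matrix_vector_mul_bounded_linear])

lemma borel_measurable_qnorm [measurable]: "qnorm Q \<in> borel_measurable borel"
  by (intro borel_measurable_continuous_onI continuous_intros)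

text \<open>The norms of \<open>Q\<close> and of its inverse are dual to each other; this is what turns the weighted
  gradient bound into a Lipschitz bound in the norm of \<open>Q\<close>.\<close>

lemma inner_le_dual_qnorms:
  assumes Q: "pos_def_sym Q"
  shows "\<bar>g \<bullet> v\<bar> \<le> qnorm (matrix_inv Q) g * qnorm Q v"
proof -
  have "x = 0" if "Q *v x = 0" for x
    using Q that unfolding pos_def_sym_def by (metis inner_zero_right less_irrefl)
  then have "invertible Q"
    by (simp add: invertible_left_inverse matrix_left_invertible_ker)
  then have inv: "Q ** matrix_inv Q = mat 1"
    unfolding invertible_def matrix_inv_def by (rule someI_ex[THEN conjunct1])
  define w where "w = matrix_inv Q *v g"
  have g: "g = Q *v w"
    by (simp add: w_def matrix_vector_mul_assoc inv)
  have "qnorm (matrix_inv Q) g = qnorm Q w"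
    unfolding qnorm_def w_def[symmetric] using g by (simp add: inner_commute)
  moreover have "\<bar>g \<bullet> v\<bar> \<le> qnorm Q v * qnorm Q w"
    using qnorm_Cauchy_Schwarz[OF Q, of v w] by (simp add: g inner_commute)
  ultimately show ?thesis by (simp add: mult.commute)
qed

section \<open>A mean value inequality for Dini derivatives\<close>

text \<open>The set of points up to which the increment satisfies the bound with slack \<open>e\<close> contains its
  supremum, because some points just to the left of the supremum are almost as high, and it extends
  beyond a supremum below \<open>b\<close>, because all points just to the right are not much higher. One-sided
  information of these two kinds thus takes the place of continuity.\<close>

lemma increment_le_of_dini_bounds:
  fixes g :: "real \<Rightarrow> real"
  assumes "a \<le> b"
    and right: "\<And>s e. a \<le> s \<Longrightarrow> s < b \<Longrightarrow> 0 < e \<Longrightarrow> \<forall>\<^sub>F u in at_right 0. g (s + u) \<le> g s + (c + e) * u"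
    and left: "\<And>s e. a < s \<Longrightarrow> s \<le> b \<Longrightarrow> 0 < e \<Longrightarrow> \<exists>\<^sub>F u in at_right 0. g s \<le> g (s - u) + (c + e) * u"
  shows "g b - g a \<le> c * (b - a)"
proof (cases "a = b")
  case False
  with \<open>a \<le> b\<close> have ab: "a < b" by simp
  have bound: "g b \<le> g a + (c + e) * (b - a)" if e: "0 < e" for e
  proof -
    define A where "A = {s \<in> {a..b}. \<forall>r\<in>{a..s}. g r \<le> g a + (c + e) * (r - a)}"
    have aA: "a \<in> A" using ab by (simp add: A_def)
    have bdd: "bdd_above A" unfolding A_def by (rule bdd_aboveI[of _ b]) auto
    define m where "m = Sup A"
    have am: "a \<le> m" using aA bdd by (simp add: m_def cSup_upper)
    have mb: "m \<le> b" unfolding m_def using aA by (intro cSup_least) (auto simp: A_def)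
    have below: "g r \<le> g a + (c + e) * (r - a)" if "a \<le> r" "r < m" for r
    proof -
      from that obtain s where "s \<in> A" "r < s"
        unfolding m_def using less_cSup_iff[OF _ bdd] aA by blast
      then show ?thesis using that by (auto simp: A_def)
    qed
    have at_m: "g m \<le> g a + (c + e) * (m - a)"
    proof (cases "m = a")
      case False
      with am have "a < m" by simp
      have "\<exists>\<^sub>F u in at_right 0. g m \<le> g (m - u) + (c + e) * u"
        using left \<open>a < m\<close> mb e by blast
      moreover have "\<forall>\<^sub>F u in at_right 0. 0 < u \<and> u < m - a"
        using \<open>a < m\<close> eventually_at_right_real[of 0 "m - a"] by simp
      ultimately have "\<exists>\<^sub>F u in at_right 0. g m \<le> g (m - u) + (c + e) * u \<and> 0 < u \<and> u < m - a"
        by (rule frequently_eventually_frequently)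
      then obtain u where u: "g m \<le> g (m - u) + (c + e) * u" "0 < u" "u < m - a"
        by (auto dest: frequently_ex)
      have "g (m - u) \<le> g a + (c + e) * ((m - u) - a)" using u by (intro below) auto
      with u(1) show ?thesis by (simp add: algebra_simps)
    qed simp
    have "m = b"
    proof (rule ccontr)
      assume "m \<noteq> b"
      with mb have "m < b" by simp
      have "\<forall>\<^sub>F u in at_right 0. g (m + u) \<le> g m + (c + e) * u"
        using right am \<open>m < b\<close> e by blast
      then obtain d where d: "0 < d" "\<And>u. 0 < u \<Longrightarrow> u < d \<Longrightarrow> g (m + u) \<le> g m + (c + e) * u"
        unfolding eventually_at_right_field by auto
      define s where "s = m + min (d / 2) (b - m)"
      have s: "m < s" "s \<le> b" "s < m + d" using d(1) \<open>m < b\<close> by (auto simp: s_def min_def)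
      have "g r \<le> g a + (c + e) * (r - a)" if r: "r \<in> {a..s}" for r
      proof -
        consider "r < m" | "r = m" | "m < r" by linarith
        then show ?thesis
        proof cases
          case 3
          then have "g r \<le> g m + (c + e) * (r - m)"
            using d(2)[of "r - m"] r s by simp
          with at_m show ?thesis by (simp add: algebra_simps)
        qed (use below at_m r in auto)
      qed
      then have "s \<in> A" using s am by (auto simp: A_def)
      then have "s \<le> m" using bdd by (simp add: m_def cSup_upper)
      with s show False by simp
    qed
    with at_m show ?thesis by simp
  qed
  have "g b - g a \<le> c * (b - a) + e" if e: "0 < e" for e
  proof -
    have "(c + e / (b - a)) * (b - a) = c * (b - a) + e" using ab by (simp add: distrib_right)
    with bound[of "e / (b - a)"] ab e show ?thesis by simp
  qed
  then show ?thesis by (rule field_le_epsilon)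
qed simp

lemma upper_dini_le_imp_eventually:
  assumes "upper_dini \<Psi> \<theta> h \<le> ereal c" and "0 < e"
  shows "\<forall>\<^sub>F u in at_right 0. \<Psi> (\<theta> + u *\<^sub>R h) \<le> \<Psi> \<theta> + (c + e) * u"
proof -
  have "upper_dini \<Psi> \<theta> h < ereal (c + e)"
    using assms by (auto intro: le_less_trans)
  then have "\<forall>\<^sub>F u in at_right 0. ereal ((\<Psi> (\<theta> + u *\<^sub>R h) - \<Psi> \<theta>) / u) < ereal (c + e)"
    unfolding upper_dini_def by (rule Limsup_lessD)
  with eventually_at_right_less[of "0::real"] show ?thesis
    by eventually_elim (simp add: field_simps)
qed

lemma upper_dini_ge_imp_frequently:
  assumes "ereal (- c) \<le> upper_dini \<Psi> \<theta> h" and "0 < e"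
  shows "\<exists>\<^sub>F u in at_right 0. \<Psi> \<theta> \<le> \<Psi> (\<theta> + u *\<^sub>R h) + (c + e) * u"
proof (rule ccontr)
  assume "\<not> ?thesis"
  then have "\<forall>\<^sub>F u in at_right 0. \<Psi> (\<theta> + u *\<^sub>R h) + (c + e) * u < \<Psi> \<theta>"
    by (simp add: not_frequently not_le)
  with eventually_at_right_less[of "0::real"]
  have "\<forall>\<^sub>F u in at_right 0. ereal ((\<Psi> (\<theta> + u *\<^sub>R h) - \<Psi> \<theta>) / u) \<le> ereal (- (c + e))"
    by eventually_elim (simp add: field_simps)
  then have "upper_dini \<Psi> \<theta> h \<le> ereal (- (c + e))"
    unfolding upper_dini_def by (rule Limsup_bounded)
  with assms(1) have "ereal (- c) \<le> ereal (- (c + e))" by (rule order_trans)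
  with assms(2) show False by simp
qed

lemma increment_le_qnorm_of_dini_bound:
  assumes C: "convex C" "x \<in> C" "y \<in> C"
    and dini: "\<And>\<theta> h. \<theta> \<in> C \<Longrightarrow> norm h = 1 \<Longrightarrow> \<bar>upper_dini \<Psi> \<theta> h\<bar> \<le> ereal (qnorm Q h)"
  shows "\<Psi> y - \<Psi> x \<le> qnorm Q (y - x)"
proof (cases "x = y")
  case False
  define l where "l = norm (y - x)"
  define h where "h = (y - x) /\<^sub>R l"
  have l: "0 < l" using False by (simp add: l_def)
  have h: "norm h = 1" "norm (- h) = 1" using l by (auto simp: h_def l_def[symmetric])
  have yx: "y = x + l *\<^sub>R h" using l by (simp add: h_def)
  have seg: "x + s *\<^sub>R h \<in> C" if "0 \<le> s" "s \<le> l" for s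
  proof -
    have "(1 - s / l) *\<^sub>R x + (s / l) *\<^sub>R y \<in> C"
      using that l C by (intro convexD) auto
    also have "(1 - s / l) *\<^sub>R x + (s / l) *\<^sub>R y = x + s *\<^sub>R h"
      by (simp add: h_def algebra_simps divide_inverse)
    finally show ?thesis .
  qed
  define g where "g s = \<Psi> (x + s *\<^sub>R h)" for s
  have "g l - g 0 \<le> qnorm Q h * (l - 0)"
  proof (rule increment_le_of_dini_bounds)
    fix s e :: real assume s: "0 \<le> s" "s < l" and e: "0 < e"
    have "\<bar>upper_dini \<Psi> (x + s *\<^sub>R h) h\<bar> \<le> ereal (qnorm Q h)"
      using s h by (intro dini seg) auto
    then have "upper_dini \<Psi> (x + s *\<^sub>R h) h \<le> ereal (qnorm Q h)"
      by (cases "upper_dini \<Psi> (x + s *\<^sub>R h) h") auto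
    from upper_dini_le_imp_eventually[OF this e]
    show "\<forall>\<^sub>F u in at_right 0. g (s + u) \<le> g s + (qnorm Q h + e) * u"
      by (simp add: g_def algebra_simps)
  next
    fix s e :: real assume s: "0 < s" "s \<le> l" and e: "0 < e"
    have "\<bar>upper_dini \<Psi> (x + s *\<^sub>R h) (- h)\<bar> \<le> ereal (qnorm Q (- h))"
      using s h by (intro dini seg) auto
    then have "ereal (- qnorm Q h) \<le> upper_dini \<Psi> (x + s *\<^sub>R h) (- h)"
      by (cases "upper_dini \<Psi> (x + s *\<^sub>R h) (- h)") (auto simp: qnorm_minus)
    from upper_dini_ge_imp_frequently[OF this e]
    show "\<exists>\<^sub>F u in at_right 0. g s \<le> g (s - u) + (qnorm Q h + e) * u"
      by (simp add: g_def algebra_simps)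
  qed (use l in simp)
  also have "qnorm Q h * (l - 0) = qnorm Q (y - x)"
    using l by (simp add: yx qnorm_scaleR)
  finally show ?thesis by (simp add: g_def yx)
qed simp

text \<open>A gradient yields all Dini derivatives, so the differentiable case is subsumed by the general one.\<close>

lemma upper_dini_of_GDERIV:
  assumes "GDERIV \<Psi> \<theta> :> g"
  shows "upper_dini \<Psi> \<theta> h = ereal (g \<bullet> h)"
proof -
  have "(\<Psi> has_derivative (\<lambda>v. v \<bullet> g)) (at (\<theta> + 0 *\<^sub>R h))"
    using assms by (simp add: gderiv_def)
  moreover have "((\<lambda>s. \<theta> + s *\<^sub>R h) has_derivative (\<lambda>s. s *\<^sub>R h)) (at 0)"
    by (auto intro!: derivative_eq_intros)
  ultimately have "((\<lambda>s. \<Psi> (\<theta> + s *\<^sub>R h)) has_derivative (\<lambda>s. (s *\<^sub>R h) \<bullet> g)) (at 0)"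
    by (rule has_derivative_compose[rotated])
  then have "((\<lambda>s. \<Psi> (\<theta> + s *\<^sub>R h)) has_field_derivative (h \<bullet> g)) (at 0)"
    by (simp add: has_field_derivative_def mult_commute_abs)
  then have "((\<lambda>s. (\<Psi> (\<theta> + s *\<^sub>R h) - \<Psi> \<theta>) / s) \<longlongrightarrow> h \<bullet> g) (at 0)"
    by (simp add: has_field_derivative_iff)
  then have "((\<lambda>s. (\<Psi> (\<theta> + s *\<^sub>R h) - \<Psi> \<theta>) / s) \<longlongrightarrow> h \<bullet> g) (at_right 0)"
    by (rule filterlim_mono) (auto simp: at_le)
  then have "((\<lambda>s. ereal ((\<Psi> (\<theta> + s *\<^sub>R h) - \<Psi> \<theta>) / s)) \<longlongrightarrow> ereal (h \<bullet> g)) (at_right 0)"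
    by simp
  then show ?thesis
    unfolding upper_dini_def by (subst lim_imp_Limsup) (auto simp: inner_commute)
qed

text \<open>For a unit vector \<open>h\<close>, duality gives that the product of its norms for \<open>Q\<close> and for the inverse of
  \<open>Q\<close> is at least \<open>1\<close>. Either form of the derivative condition therefore bounds the Dini derivative in
  direction \<open>h\<close> by \<open>qnorm Q h\<close>.\<close>

lemma qnorm_Lipschitz_of_derivative_bound:
  assumes Q: "pos_def_sym Q" and C: "convex C" "x \<in> C" "y \<in> C"
    and bound: "(\<forall>\<theta>\<in>C. (SUP h \<in> {h. norm h = 1}.
          \<bar>upper_dini \<Psi> \<theta> h\<bar> * ereal (qnorm (matrix_inv Q) h)) \<le> 1) \<or>
        (\<forall>\<theta>\<in>C. \<exists>g. GDERIV \<Psi> \<theta> :> g \<and> qnorm (matrix_inv Q) g \<le> 1)"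
  shows "\<bar>\<Psi> x - \<Psi> y\<bar> \<le> qnorm Q (x - y)"
proof -
  have dini: "\<bar>upper_dini \<Psi> \<theta> h\<bar> \<le> ereal (qnorm Q h)" if th: "\<theta> \<in> C" and h: "norm h = 1" for \<theta> h
    using bound
  proof
    assume "\<forall>\<theta>\<in>C. (SUP h \<in> {h. norm h = 1}. \<bar>upper_dini \<Psi> \<theta> h\<bar> * ereal (qnorm (matrix_inv Q) h)) \<le> 1"
    then have le1: "\<bar>upper_dini \<Psi> \<theta> h\<bar> * ereal (qnorm (matrix_inv Q) h) \<le> 1"
      using th h by (auto simp: SUP_le_iff)
    have "1 \<le> qnorm (matrix_inv Q) h * qnorm Q h"
      using inner_le_dual_qnorms[OF Q, of h h] h by (simp add: norm_eq_1)
    moreover have hQ: "0 < qnorm Q h" using h by (intro qnorm_pos[OF Q]) auto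
    ultimately have pos: "0 < qnorm (matrix_inv Q) h"
      by (smt (verit) mult_nonpos_nonneg)
    show ?thesis
    proof (cases "upper_dini \<Psi> \<theta> h")
      case (real r)
      then have "\<bar>r\<bar> * qnorm (matrix_inv Q) h \<le> 1" using le1 by simp
      also have "\<dots> \<le> qnorm Q h * qnorm (matrix_inv Q) h"
        using \<open>1 \<le> _\<close> by (simp add: mult.commute)
      finally show ?thesis using pos real by simp
    qed (use le1 pos in auto)
  next
    assume "\<forall>\<theta>\<in>C. \<exists>g. GDERIV \<Psi> \<theta> :> g \<and> qnorm (matrix_inv Q) g \<le> 1"
    then obtain g where g: "GDERIV \<Psi> \<theta> :> g" "qnorm (matrix_inv Q) g \<le> 1" using th by blast
    have "\<bar>g \<bullet> h\<bar> \<le> 1 * qnorm Q h"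
      using inner_le_dual_qnorms[OF Q, of g h] g(2) qnorm_nonneg[OF Q, of h]
      by (meson mult_right_mono order_trans)
    then show ?thesis using upper_dini_of_GDERIV[OF g(1)] by simp
  qed
  show ?thesis
    using increment_le_qnorm_of_dini_bound[OF C dini]
      increment_le_qnorm_of_dini_bound[OF C(1,3,2) dini]
    by (simp add: qnorm_minus_commute abs_le_iff)
qed

section \<open>The flow of the mean field\<close>

text \<open>The integral \<open>v\<close> is tested against itself in the inner product of \<open>Q\<close>, which reduces the claim to
  the Cauchy-Schwarz inequality under the integral.\<close>

lemma qnorm_integral_le:
  assumes Q: "pos_def_sym Q" and f: "f integrable_on S" and g: "g integrable_on S"
    and le: "\<And>t. t \<in> S \<Longrightarrow> qnorm Q (f t) \<le> g t"
  shows "qnorm Q (integral S f) \<le> integral S g"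
proof (rule qnorm_le_of_form_le[OF Q])
  let ?v = "integral S f"
  have lin: "bounded_linear (\<lambda>x. x \<bullet> (Q *v ?v))" by (rule bounded_linear_inner_left)
  have "?v \<bullet> (Q *v ?v) = integral S (\<lambda>t. f t \<bullet> (Q *v ?v))"
    using integral_linear[OF f lin] by (simp add: o_def)
  also have "\<dots> \<le> integral S (\<lambda>t. g t * qnorm Q ?v)"
  proof (rule integral_le)
    show "(\<lambda>t. f t \<bullet> (Q *v ?v)) integrable_on S"
      using integrable_linear[OF f lin] by (simp add: o_def)
    show "(\<lambda>t. g t * qnorm Q ?v) integrable_on S"
      using g by (rule integrable_on_mult_left)
    show "f t \<bullet> (Q *v ?v) \<le> g t * qnorm Q ?v" if "t \<in> S" for t
      using qnorm_Cauchy_Schwarz[OF Q, of "f t" ?v] le[OF that] qnorm_nonneg[OF Q, of ?v]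
      by (meson abs_le_D1 mult_right_mono order_trans)
  qed
  finally show "?v \<bullet> (Q *v ?v) \<le> integral S g * qnorm Q ?v" by simp
  show "0 \<le> integral S g"
    using le qnorm_nonneg[OF Q] by (intro integral_nonneg g) (meson order_trans)
qed

text \<open>With \<open>W\<close> the integral of \<open>w\<close>, the function \<open>exp (- D t) W t\<close> is nonincreasing and starts at \<open>0\<close>.\<close>

lemma gronwall_zero:
  fixes w :: "real \<Rightarrow> real"
  assumes cont: "continuous_on {0..b} w"
    and nonneg: "\<And>t. t \<in> {0..b} \<Longrightarrow> 0 \<le> w t"
    and le: "\<And>t. t \<in> {0..b} \<Longrightarrow> w t \<le> D * integral {0..t} w"
    and t: "t \<in> {0..b}" and D: "0 \<le> D"
  shows "w t = 0"
proof -
  define W where "W t = integral {0..t} w" for t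
  have deriv: "(W has_real_derivative w s) (at s within {0..b})" if "s \<in> {0..b}" for s
    unfolding W_def using integral_has_real_derivative[OF cont that] .
  have "exp (- D * t) * W t \<le> exp (- D * 0) * W 0"
  proof (rule DERIV_nonpos_imp_decreasing_open[where f = "\<lambda>s. exp (- D * s) * W s"])
    fix s assume s: "0 < s" "s < t"
    have W': "(W has_real_derivative w s) (at s)"
      using deriv[of s] s t by (simp add: at_within_Icc_at)
    have "((\<lambda>s. exp (- D * s)) has_real_derivative - D * exp (- D * s)) (at s)"
      by (auto intro!: derivative_eq_intros)
    from DERIV_mult[OF this W']
    have "((\<lambda>s. exp (- D * s) * W s) has_real_derivative exp (- D * s) * (w s - D * W s)) (at s)"
      by (rule DERIV_cong) (simp add: algebra_simps)
    moreover have "exp (- D * s) * (w s - D * W s) \<le> 0"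
      using le[of s] s t by (intro mult_nonneg_nonpos) (auto simp: W_def)
    ultimately show "\<exists>y. ((\<lambda>s. exp (- D * s) * W s) has_real_derivative y) (at s) \<and> y \<le> 0"
      by blast
  next
    have "continuous_on {0..b} W"
      by (rule DERIV_continuous_on[OF deriv])
    then show "continuous_on {0..t} (\<lambda>s. exp (- D * s) * W s)"
      using t by (intro continuous_intros) (auto elim: continuous_on_subset)
  qed (use t in simp)
  then have "W t \<le> 0" by (simp add: W_def mult_le_0_iff)
  then have "w t \<le> 0"
    using le[OF t] D unfolding W_def by (meson mult_nonneg_nonpos order_trans)
  with nonneg[OF t] show ?thesis by simp
qed

lemma flow_solution_start: "flow_solution F A \<theta> b y \<Longrightarrow> 0 \<le> b \<Longrightarrow> y 0 = \<theta>"
  by (simp add: flow_solution_def)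

lemma flow_solution_integrable:
  assumes "flow_solution F A \<theta> b y" "0 \<le> s" "t \<le> b"
  shows "(\<lambda>\<tau>. F (y \<tau>)) integrable_on {s..t}"
proof (rule integrable_on_subinterval)
  show "(\<lambda>\<tau>. F (y \<tau>)) integrable_on {0..b}"
    using assms(1) unfolding flow_solution_def by (blast intro: set_lebesgue_integral_eq_integral(1))
qed (use assms in auto)

lemma flow_solution_increment:
  assumes "flow_solution F A \<theta> b y" "0 \<le> s" "s \<le> t" "t \<le> b"
  shows "y t - y s = integral {s..t} (\<lambda>\<tau>. F (y \<tau>))"
proof -
  have "integral {0..s} (\<lambda>\<tau>. F (y \<tau>)) + integral {s..t} (\<lambda>\<tau>. F (y \<tau>))
      = integral {0..t} (\<lambda>\<tau>. F (y \<tau>))"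
    using assms flow_solution_integrable[OF assms(1), of 0 t]
    by (intro Henstock_Kurzweil_Integration.integral_combine) auto
  moreover have "y s = \<theta> + integral {0..s} (\<lambda>\<tau>. F (y \<tau>))" "y t = \<theta> + integral {0..t} (\<lambda>\<tau>. F (y \<tau>))"
    using assms by (auto simp: flow_solution_def)
  ultimately show ?thesis by (simp add: algebra_simps)
qed

lemma flow_solution_continuous:
  assumes "flow_solution F A \<theta> b y"
  shows "continuous_on {0..b} y"
proof -
  have "continuous_on {0..b} (\<lambda>t. \<theta> + integral {0..t} (\<lambda>\<tau>. F (y \<tau>)))"
    using flow_solution_integrable[OF assms, of 0 b]
    by (intro continuous_intros indefinite_integral_continuous_1) auto
  moreover have "\<And>t. t \<in> {0..b} \<Longrightarrow> \<theta> + integral {0..t} (\<lambda>\<tau>. F (y \<tau>)) = y t"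
    using assms by (simp add: flow_solution_def)
  ultimately show ?thesis by (rule continuous_on_eq)
qed

lemma flow_solution_unique:
  assumes Q: "pos_def_sym Q" and D: "0 \<le> D"
    and lip: "\<And>\<theta> \<theta>'. \<theta> \<in> A \<Longrightarrow> \<theta>' \<in> A \<Longrightarrow> qnorm Q (F \<theta> - F \<theta>') \<le> D * qnorm Q (\<theta> - \<theta>')"
    and y: "flow_solution F A \<theta>\<^sub>0 b y" and z: "flow_solution F A \<theta>\<^sub>0 b z"
    and t: "t \<in> {0..b}"
  shows "y t = z t"
proof -
  have cont: "continuous_on {0..b} (\<lambda>t. qnorm Q (y t - z t))"
    by (intro continuous_intros flow_solution_continuous[OF y] flow_solution_continuous[OF z])
  have "qnorm Q (y t - z t) = 0"
  proof (rule gronwall_zero[OF cont _ _ t D])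
    fix s assume s: "s \<in> {0..b}"
    show "0 \<le> qnorm Q (y s - z s)" by (rule qnorm_nonneg[OF Q])
    have int: "(\<lambda>\<tau>. F (y \<tau>)) integrable_on {0..s}" "(\<lambda>\<tau>. F (z \<tau>)) integrable_on {0..s}"
      using s y z by (auto intro: flow_solution_integrable)
    have cont_s: "(\<lambda>t. qnorm Q (y t - z t)) integrable_on {0..s}"
      using s by (intro integrable_continuous_real continuous_on_subset[OF cont]) auto
    have "y s - z s = integral {0..s} (\<lambda>\<tau>. F (y \<tau>) - F (z \<tau>))"
      using y z s by (simp add: flow_solution_def Henstock_Kurzweil_Integration.integral_diff int)
    also have "qnorm Q \<dots> \<le> integral {0..s} (\<lambda>\<tau>. D * qnorm Q (y \<tau> - z \<tau>))"
      using s y z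
      by (intro qnorm_integral_le[OF Q] Henstock_Kurzweil_Integration.integrable_diff int
          integrable_on_mult_right cont_s lip) (auto simp: flow_solution_def)
    finally show "qnorm Q (y s - z s) \<le> D * integral {0..s} (\<lambda>t. qnorm Q (y t - z t))"
      by simp
  qed
  then show ?thesis using qnorm_pos[OF Q, of "y t - z t"] by fastforce
qed

lemma bounded_measurable_integrable_lebesgue_on:
  fixes r :: "real \<Rightarrow> real"
  assumes "r \<in> borel_measurable (lebesgue_on {s..u})" and "\<And>t. t \<in> {s..u} \<Longrightarrow> \<bar>r t\<bar> \<le> B"
  shows "integrable (lebesgue_on {s..u}) r"
proof -
  have "finite_measure (lebesgue_on {s..u})"
    by (metis cbox_interval finite_measure_lebesgue_on lmeasurable_cbox)
  then show ?thesis
    using assms by (intro finite_measure.integrable_const_bound[where B=B]) (auto intro!: AE_I2)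
qed

text \<open>Repeated integration, by Fubini over the triangle \<open>s \<le> x \<le> t \<le> u\<close>.\<close>

lemma integral_of_integral:
  fixes r :: "real \<Rightarrow> real"
  assumes su: "s \<le> u" and meas: "r \<in> borel_measurable (lebesgue_on {s..u})"
    and bound: "\<And>t. t \<in> {s..u} \<Longrightarrow> \<bar>r t\<bar> \<le> B"
  shows "integral {s..u} (\<lambda>t. integral {s..t} r) = integral {s..u} (\<lambda>t. (u - t) * r t)"
    and "(\<lambda>t. integral {s..t} r) integrable_on {s..u}"
    and "(\<lambda>t. (u - t) * r t) integrable_on {s..u}"
proof -
  define L where "L = lebesgue_on {s..u}"
  have fin: "finite_measure L" unfolding L_def
    by (metis cbox_interval finite_measure_lebesgue_on lmeasurable_cbox)
  then interpret L: finite_measure L .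
  interpret P: pair_sigma_finite L L ..
  have space_L: "space L = {s..u}" by (simp add: L_def space_restrict_space)
  have r [measurable]: "r \<in> borel_measurable L" using meas by (simp add: L_def)
  have id [measurable]: "(\<lambda>x. x) \<in> borel_measurable L"
    unfolding L_def by (intro measurable_restrict_space1 measurable_completion) simp
  define f where "f t x = (if x \<le> t then r x else 0)" for t x
  have f [measurable]: "case_prod f \<in> borel_measurable (L \<Otimes>\<^sub>M L)"
    unfolding f_def case_prod_unfold by measurable
  have "finite_measure (L \<Otimes>\<^sub>M L)"
    using finite_measure_pair_measure[OF fin fin] .
  moreover have "AE z in L \<Otimes>\<^sub>M L. norm (case_prod f z) \<le> \<bar>B\<bar>"
    using bound by (intro AE_I2) (fastforce simp: f_def space_pair_measure space_L)
  ultimately have int_f: "integrable (L \<Otimes>\<^sub>M L) (case_prod f)"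
    using f by (intro finite_measure.integrable_const_bound) auto
  have inner1: "(\<integral>x. f t x \<partial>L) = integral {s..t} r" if t: "t \<in> {s..u}" for t
  proof -
    have int: "integrable L (f t)"
      unfolding L_def
    proof (rule bounded_measurable_integrable_lebesgue_on)
      show "f t \<in> borel_measurable (lebesgue_on {s..u})"
        unfolding L_def[symmetric] f_def by measurable
      show "\<bar>f t x\<bar> \<le> \<bar>B\<bar>" if "x \<in> {s..u}" for x
        using bound[OF that] by (auto simp: f_def)
    qed
    have "(\<integral>x. f t x \<partial>L) = integral {s..u} (f t)"
      using int unfolding L_def by (rule lebesgue_integral_eq_integral) simp
    also have "\<dots> = integral {s..u} (\<lambda>x. if x \<in> {..t} then r x else 0)"
      by (simp add: f_def[abs_def])
    also have "\<dots> = integral ({..t} \<inter> {s..u}) r"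
      by (rule integral_restrict_Int)
    also have "{..t} \<inter> {s..u} = {s..t}" using t by auto
    finally show ?thesis .
  qed
  have inner2: "(\<integral>t. f t x \<partial>L) = (u - x) * r x" if x: "x \<in> {s..u}" for x
  proof -
    have "(\<integral>t. f t x \<partial>L) = (\<integral>t. indicator {x..u} t * r x \<partial>L)"
      by (intro Bochner_Integration.integral_cong) (auto simp: f_def space_L)
    also have "\<dots> = measure L {x..u} * r x"
    proof -
      have "{x..u} \<in> sets L" using x by (auto simp: L_def sets_restrict_space_iff)
      then show ?thesis using L.emeasure_finite[of "{x..u}"] by simp
    qed
    also have "measure L {x..u} = u - x"
      using x unfolding L_def by (subst measure_restrict_space) auto
    finally show ?thesis .
  qed
  have int1: "integrable L (\<lambda>t. \<integral>x. f t x \<partial>L)" using P.integrable_fst'[OF int_f] by simp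
  have int2: "integrable L (\<lambda>x. \<integral>t. f t x \<partial>L)" using P.integrable_snd[OF int_f] .
  have int1': "integrable L (\<lambda>t. integral {s..t} r)"
    using int1 by (subst Bochner_Integration.integrable_cong[OF refl, symmetric]) (auto simp: space_L inner1)
  have int2': "integrable L (\<lambda>x. (u - x) * r x)"
    using int2 by (subst Bochner_Integration.integrable_cong[OF refl, symmetric]) (auto simp: space_L inner2)
  show "(\<lambda>t. integral {s..t} r) integrable_on {s..u}"
    using int1' unfolding L_def by (intro integrable_on_lebesgue_on) auto
  show "(\<lambda>t. (u - t) * r t) integrable_on {s..u}"
    using int2' unfolding L_def by (intro integrable_on_lebesgue_on) auto
  have "(\<integral>t. integral {s..t} r \<partial>L) = (\<integral>t. (\<integral>x. f t x \<partial>L) \<partial>L)"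
    by (intro Bochner_Integration.integral_cong) (auto simp: inner1 space_L)
  also have "\<dots> = (\<integral>x. (\<integral>t. f t x \<partial>L) \<partial>L)"
    using P.Fubini_integral[OF int_f] by simp
  also have "\<dots> = (\<integral>x. (u - x) * r x \<partial>L)"
    by (intro Bochner_Integration.integral_cong) (auto simp: inner2 space_L)
  finally show "integral {s..u} (\<lambda>t. integral {s..t} r) = integral {s..u} (\<lambda>t. (u - t) * r t)"
    using int1' int2' unfolding L_def by (simp add: lebesgue_integral_eq_integral)
qed

text \<open>The error of one explicit Euler step of length \<open>u - s\<close>: along the flow the field changes by at
  most \<open>D\<close> times the distance travelled since time \<open>s\<close>, which is at most the integral of the speed.\<close>

lemma euler_step_defect_le:
  assumes Q: "pos_def_sym Q" and D: "0 \<le> D"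
    and lip: "\<And>\<theta> \<theta>'. \<theta> \<in> A \<Longrightarrow> \<theta>' \<in> A \<Longrightarrow> qnorm Q (F \<theta> - F \<theta>') \<le> D * qnorm Q (\<theta> - \<theta>')"
    and y: "flow_solution F A \<theta>\<^sub>0 b y"
    and speed: "\<And>t. t \<in> {0..b} \<Longrightarrow> qnorm Q (F (y t)) \<le> r t"
    and meas: "r \<in> borel_measurable (lebesgue_on {0..b})"
    and bound: "\<And>t. t \<in> {0..b} \<Longrightarrow> r t \<le> B"
    and su: "0 \<le> s" "s \<le> u" "u \<le> b"
  shows "qnorm Q (y u - y s - (u - s) *\<^sub>R F (y s)) \<le> D * integral {s..u} (\<lambda>t. (u - t) * r t)"
proof -
  have r_nonneg: "0 \<le> r t" if "t \<in> {0..b}" for t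
    using speed[OF that] qnorm_nonneg[OF Q] by (meson order_trans)
  have r_abs: "\<bar>r t\<bar> \<le> B" if "t \<in> {s..u}" for t
    using r_nonneg[of t] bound[of t] that su by auto
  have r_meas: "r \<in> borel_measurable (lebesgue_on {s..t})" if "t \<le> b" for t
    using su that by (intro measurable_restrict_mono[OF meas]) auto
  have r_int: "r integrable_on {s..t}" if "t \<in> {s..u}" for t
    using that su r_abs
    by (intro integrable_on_lebesgue_on bounded_measurable_integrable_lebesgue_on[where B=B] r_meas) auto
  note rep = integral_of_integral[OF su(2) r_meas[OF su(3)] r_abs]
  have int: "(\<lambda>t. F (y t)) integrable_on {s..t}" if "t \<le> u" for t
    using su that by (intro flow_solution_integrable[OF y]) auto
  have "y u - y s - (u - s) *\<^sub>R F (y s) = integral {s..u} (\<lambda>t. F (y t) - F (y s))"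
    using flow_solution_increment[OF y su] su
    by (subst Henstock_Kurzweil_Integration.integral_diff) (auto intro: int)
  also have "qnorm Q \<dots> \<le> integral {s..u} (\<lambda>t. D * integral {s..t} r)"
  proof (rule qnorm_integral_le[OF Q])
    fix t assume t: "t \<in> {s..u}"
    have "qnorm Q (F (y t) - F (y s)) \<le> D * qnorm Q (y t - y s)"
      using y t su by (intro lip) (auto simp: flow_solution_def)
    also have "qnorm Q (y t - y s) \<le> integral {s..t} r"
      using t su by (subst flow_solution_increment[OF y])
        (auto intro!: qnorm_integral_le[OF Q] int r_int speed)
    finally show "qnorm Q (F (y t) - F (y s)) \<le> D * integral {s..t} r"
      using D by (simp add: mult_left_mono)
  qed (use int[of u] rep(2) in \<open>auto intro: Henstock_Kurzweil_Integration.integrable_diff integrable_on_mult_right\<close>)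
  finally show ?thesis using rep(1) by simp
qed

section \<open>Second moments\<close>

text \<open>Minkowski's inequality in \<open>L\<^sup>2\<close> when one of the summands is constant: expand the square and bound the
  mean by the root mean square.\<close>

lemma nn_integral_affine_square_le:
  fixes f :: "'a \<Rightarrow> real"
  assumes "prob_space \<mu>" and [measurable]: "f \<in> borel_measurable \<mu>"
    and nonneg: "0 \<le> a" "0 \<le> b" "0 \<le> c"
    and sq: "(\<integral>\<^sup>+x. ennreal ((f x)\<^sup>2) \<partial>\<mu>) \<le> ennreal (a\<^sup>2)"
  shows "(\<integral>\<^sup>+x. ennreal ((c * f x + b)\<^sup>2) \<partial>\<mu>) \<le> ennreal ((c * a + b)\<^sup>2)"
proof -
  interpret prob_space \<mu> by fact
  have int2: "integrable \<mu> (\<lambda>x. (f x)\<^sup>2)"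
    using sq by (intro integrableI_nonneg) (auto intro: le_less_trans)
  have int1: "integrable \<mu> f"
    by (rule square_integrable_imp_integrable) (use int2 in auto)
  have le2: "expectation (\<lambda>x. (f x)\<^sup>2) \<le> a\<^sup>2"
    using sq int2 by (simp add: nn_integral_eq_integral)
  have "(expectation f)\<^sup>2 \<le> expectation (\<lambda>x. (f x)\<^sup>2)"
    using variance_eq[OF int1 int2] variance_positive[of f] by simp
  with le2 have "(expectation f)\<^sup>2 \<le> a\<^sup>2" by simp
  then have le1: "expectation f \<le> a"
    using nonneg(1) by (rule power2_le_imp_le)
  have "(\<integral>\<^sup>+x. ennreal ((c * f x + b)\<^sup>2) \<partial>\<mu>)
      = (\<integral>\<^sup>+x. ennreal (c\<^sup>2 * (f x)\<^sup>2 + 2 * c * b * f x + b\<^sup>2) \<partial>\<mu>)"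
    by (simp add: power2_sum power_mult_distrib algebra_simps)
  also have "\<dots> = ennreal (\<integral>x. c\<^sup>2 * (f x)\<^sup>2 + 2 * c * b * f x + b\<^sup>2 \<partial>\<mu>)"
  proof (rule nn_integral_eq_integral)
    show "integrable \<mu> (\<lambda>x. c\<^sup>2 * (f x)\<^sup>2 + 2 * c * b * f x + b\<^sup>2)"
      using int1 int2 by simp
    have "c\<^sup>2 * (f x)\<^sup>2 + 2 * c * b * f x + b\<^sup>2 = (c * f x + b)\<^sup>2" for x
      by (simp add: power2_sum power_mult_distrib algebra_simps)
    then show "AE x in \<mu>. 0 \<le> c\<^sup>2 * (f x)\<^sup>2 + 2 * c * b * f x + b\<^sup>2" by simp
  qed
  also have "(\<integral>x. c\<^sup>2 * (f x)\<^sup>2 + 2 * c * b * f x + b\<^sup>2 \<partial>\<mu>)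
      = c\<^sup>2 * expectation (\<lambda>x. (f x)\<^sup>2) + 2 * c * b * expectation f + b\<^sup>2"
    using int1 int2 by (simp add: prob_space)
  also have "\<dots> \<le> c\<^sup>2 * a\<^sup>2 + 2 * c * b * a + b\<^sup>2"
    using le1 le2 nonneg by (intro add_mono mult_left_mono) auto
  also have "\<dots> = (c * a + b)\<^sup>2"
    by (simp add: power2_sum power_mult_distrib algebra_simps)
  finally show ?thesis by (simp add: ennreal_leI)
qed

text \<open>The centred noise is orthogonal to constants in the inner product of \<open>Q\<close>, so its second moment
  simply adds to the square of the deterministic part, and is itself at most the uncentred one.\<close>

lemma nn_integral_noise_square_le:
  fixes P :: "(real ^ 'd) measure"
  assumes P: "prob_space P" "sets P = sets borel" and Q: "pos_def_sym Q"
    and mean: "integrable P (\<lambda>x. x)"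
    and sq: "(\<integral>\<^sup>+x. ennreal ((qnorm Q x)\<^sup>2) \<partial>P) \<le> ennreal (r\<^sup>2)" and r: "0 \<le> r"
  shows "(\<integral>\<^sup>+x. ennreal ((qnorm Q (v + a *\<^sub>R (x - (LINT x|P. x))))\<^sup>2) \<partial>P)
      \<le> ennreal ((qnorm Q v)\<^sup>2 + a\<^sup>2 * r\<^sup>2)"
    and "qnorm Q (LINT x|P. x) \<le> r"
proof -
  interpret prob_space P by fact
  note [measurable_cong] = P(2)
  define m where "m = (LINT x|P. x)"
  have int2: "integrable P (\<lambda>x. (qnorm Q x)\<^sup>2)"
    using sq by (intro integrableI_nonneg) (auto intro: le_less_trans)
  have le2: "expectation (\<lambda>x. (qnorm Q x)\<^sup>2) \<le> r\<^sup>2"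
    using sq int2 by (simp add: nn_integral_eq_integral)
  have moment: "(\<integral>\<^sup>+x. ennreal ((qnorm Q (v + a *\<^sub>R (x - m)))\<^sup>2) \<partial>P)
      = ennreal ((qnorm Q v)\<^sup>2 + a\<^sup>2 * (expectation (\<lambda>x. (qnorm Q x)\<^sup>2) - (qnorm Q m)\<^sup>2))"
    and moment_nonneg:
      "0 \<le> (qnorm Q v)\<^sup>2 + a\<^sup>2 * (expectation (\<lambda>x. (qnorm Q x)\<^sup>2) - (qnorm Q m)\<^sup>2)" for v a
  proof -
    define w where "w = v - a *\<^sub>R m"
    have expand: "(qnorm Q (v + a *\<^sub>R (x - m)))\<^sup>2
        = (qnorm Q w)\<^sup>2 + 2 * a * (x \<bullet> (Q *v w)) + a\<^sup>2 * (qnorm Q x)\<^sup>2" for x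
    proof -
      have "v + a *\<^sub>R (x - m) = w + a *\<^sub>R x" by (simp add: w_def algebra_simps)
      then show ?thesis
        by (simp add: qnorm_add_power2[OF Q] qnorm_scaleR power_mult_distrib)
    qed
    have int: "integrable P (\<lambda>x. (qnorm Q w)\<^sup>2 + 2 * a * (x \<bullet> (Q *v w)) + a\<^sup>2 * (qnorm Q x)\<^sup>2)"
      using mean int2 by simp
    have "(\<integral>\<^sup>+x. ennreal ((qnorm Q (v + a *\<^sub>R (x - m)))\<^sup>2) \<partial>P)
        = ennreal (\<integral>x. (qnorm Q (v + a *\<^sub>R (x - m)))\<^sup>2 \<partial>P)"
      using int unfolding expand[symmetric] by (intro nn_integral_eq_integral) auto
    moreover have "(\<integral>x. (qnorm Q (v + a *\<^sub>R (x - m)))\<^sup>2 \<partial>P)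
        = (qnorm Q w)\<^sup>2 + 2 * a * (m \<bullet> (Q *v w)) + a\<^sup>2 * expectation (\<lambda>x. (qnorm Q x)\<^sup>2)"
      unfolding expand using mean int2 by (simp add: m_def prob_space)
    moreover have "(qnorm Q v)\<^sup>2 = (qnorm Q w)\<^sup>2 + 2 * a * (m \<bullet> (Q *v w)) + a\<^sup>2 * (qnorm Q m)\<^sup>2"
      using expand[of m] by simp
    ultimately have eq: "(\<integral>x. (qnorm Q (v + a *\<^sub>R (x - m)))\<^sup>2 \<partial>P)
        = (qnorm Q v)\<^sup>2 + a\<^sup>2 * (expectation (\<lambda>x. (qnorm Q x)\<^sup>2) - (qnorm Q m)\<^sup>2)"
      and nn: "(\<integral>\<^sup>+x. ennreal ((qnorm Q (v + a *\<^sub>R (x - m)))\<^sup>2) \<partial>P)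
        = ennreal (\<integral>x. (qnorm Q (v + a *\<^sub>R (x - m)))\<^sup>2 \<partial>P)"
      by (simp_all add: algebra_simps)
    from nn show "(\<integral>\<^sup>+x. ennreal ((qnorm Q (v + a *\<^sub>R (x - m)))\<^sup>2) \<partial>P)
      = ennreal ((qnorm Q v)\<^sup>2 + a\<^sup>2 * (expectation (\<lambda>x. (qnorm Q x)\<^sup>2) - (qnorm Q m)\<^sup>2))"
      unfolding eq .
    show "0 \<le> (qnorm Q v)\<^sup>2 + a\<^sup>2 * (expectation (\<lambda>x. (qnorm Q x)\<^sup>2) - (qnorm Q m)\<^sup>2)"
      unfolding eq[symmetric] by simp
  qed
  have "a\<^sup>2 * (expectation (\<lambda>x. (qnorm Q x)\<^sup>2) - (qnorm Q m)\<^sup>2) \<le> a\<^sup>2 * r\<^sup>2"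
    using le2 zero_le_power2[of "qnorm Q m"] by (intro mult_left_mono zero_le_power2) linarith
  then show "(\<integral>\<^sup>+x. ennreal ((qnorm Q (v + a *\<^sub>R (x - (LINT x|P. x))))\<^sup>2) \<partial>P)
      \<le> ennreal ((qnorm Q v)\<^sup>2 + a\<^sup>2 * r\<^sup>2)"
    unfolding m_def[symmetric] moment by (intro ennreal_leI) simp
  have "(qnorm Q m)\<^sup>2 \<le> r\<^sup>2"
    using moment_nonneg[of 0 1] le2 by simp
  then show "qnorm Q (LINT x|P. x) \<le> r"
    unfolding m_def[symmetric] using r by (rule power2_le_imp_le)
qed

lemma nn_integral_displacement_square_le:
  fixes P :: "(real ^ 'd) measure"
  assumes P: "prob_space P" "sets P = sets borel" and Q: "pos_def_sym Q"
    and sq: "(\<integral>\<^sup>+x. ennreal ((qnorm Q x)\<^sup>2) \<partial>P) \<le> ennreal (r\<^sup>2)" and r: "0 \<le> r" and a: "0 \<le> a"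
  shows "(\<integral>\<^sup>+x. ennreal ((qnorm Q (v + a *\<^sub>R x))\<^sup>2) \<partial>P) \<le> ennreal ((qnorm Q v + a * r)\<^sup>2)"
proof -
  note [measurable_cong] = P(2)
  have "qnorm Q (v + a *\<^sub>R x) \<le> a * qnorm Q x + qnorm Q v" for x
    using qnorm_triangle[OF Q, of v "a *\<^sub>R x"] a by (simp add: qnorm_scaleR)
  then have "(\<integral>\<^sup>+x. ennreal ((qnorm Q (v + a *\<^sub>R x))\<^sup>2) \<partial>P)
      \<le> (\<integral>\<^sup>+x. ennreal ((a * qnorm Q x + qnorm Q v)\<^sup>2) \<partial>P)"
    by (intro nn_integral_mono ennreal_leI power_mono qnorm_nonneg[OF Q])
  also have "\<dots> \<le> ennreal ((a * r + qnorm Q v)\<^sup>2)"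
    by (intro nn_integral_affine_square_le P qnorm_nonneg[OF Q] sq r a) simp
  finally show ?thesis by (simp add: add.commute)
qed

lemma ennreal_power2_le_imp_le:
  fixes x y :: ennreal
  assumes "x\<^sup>2 \<le> y\<^sup>2"
  shows "x \<le> y"
proof (cases y)
  case (real b)
  show ?thesis
  proof (cases x)
    case (real a)
    with assms \<open>y = ennreal b\<close> \<open>0 \<le> b\<close> have "a\<^sup>2 \<le> b\<^sup>2" by (simp add: ennreal_power)
    then have "a \<le> b" using \<open>0 \<le> b\<close> by (rule power2_le_imp_le)
    with real \<open>y = ennreal b\<close> show ?thesis by (simp add: ennreal_leI)
  next
    case top
    with assms \<open>y = ennreal b\<close> \<open>0 \<le> b\<close> show ?thesis
      by (simp add: ennreal_power top_unique)
  qed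
qed simp

lemma esqrt_le_iff: "esqrt e \<le> ereal c \<longleftrightarrow> 0 \<le> c \<and> e \<le> ennreal (c\<^sup>2)"
proof (cases e)
  case (real x)
  have "sqrt x \<le> c \<longleftrightarrow> 0 \<le> c \<and> x \<le> c\<^sup>2"
    using real(1) by (meson order_trans real_le_lsqrt real_sqrt_ge_zero sqrt_le_D)
  then show ?thesis using real by (simp add: esqrt_def)
qed (simp add: esqrt_def top_unique)

section \<open>The weighted chain started at a fixed point\<close>

text \<open>A state \<open>(\<theta>\<^sub>0, \<theta>, p)\<close> records the starting point, the current iterate and the product of the
  growth factors \<open>1 + \<alpha> l\<close> collected so far. Carrying the starting point along makes the laws below
  jointly measurable kernels, so that the conditional expectation given the past is an integral
  against the law started at a frozen point. Within such an integral the starting point is a constant,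
  and \<open>Q\<close>, \<open>R\<close> and the flow may depend on it arbitrarily.\<close>

definition chain_step ::
    "real \<Rightarrow> ((real ^ 'd) \<times> (real ^ 'd) \<Rightarrow> real) \<Rightarrow> (real ^ 'd) \<times> (real ^ 'd) \<times> real \<Rightarrow> real ^ 'd
      \<Rightarrow> (real ^ 'd) \<times> (real ^ 'd) \<times> real"
  where "chain_step \<alpha> l z x =
    (fst z, fst (snd z) + \<alpha> *\<^sub>R x, snd (snd z) * (1 + \<alpha> * l (fst z, fst (snd z))))"

primrec chain_law ::
    "(real ^ 'd \<Rightarrow> (real ^ 'd) measure) \<Rightarrow> real \<Rightarrow> ((real ^ 'd) \<times> (real ^ 'd) \<Rightarrow> real)
      \<Rightarrow> nat \<Rightarrow> (real ^ 'd) \<times> (real ^ 'd) \<times> real \<Rightarrow> ((real ^ 'd) \<times> (real ^ 'd) \<times> real) measure"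
  where
    "chain_law K \<alpha> l 0 z = return borel z"
  | "chain_law K \<alpha> l (Suc k) z =
      chain_law K \<alpha> l k z \<bind> (\<lambda>w. distr (K (fst (snd w))) borel (chain_step \<alpha> l w))"

locale weighted_chain =
  fixes K :: "real ^ 'd \<Rightarrow> (real ^ 'd) measure"
    and \<alpha> :: real
    and l :: "(real ^ 'd) \<times> (real ^ 'd) \<Rightarrow> real"
  assumes kernel_measurable [measurable]: "K \<in> borel \<rightarrow>\<^sub>M prob_algebra borel"
    and weight_measurable [measurable]: "l \<in> borel_measurable borel"
begin

lemma chain_step_measurable [measurable]:
  "(\<lambda>(z, x). chain_step \<alpha> l z x) \<in> borel \<Otimes>\<^sub>M borel \<rightarrow>\<^sub>M borel"
  unfolding chain_step_def by (simp add: borel_prod[symmetric])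

lemma chain_kernel_measurable [measurable]:
  "(\<lambda>w. distr (K (fst (snd w))) borel (chain_step \<alpha> l w)) \<in> borel \<rightarrow>\<^sub>M prob_algebra borel"
proof -
  have "(\<lambda>w. K (fst (snd w))) \<in> (borel :: ((real ^ 'd) \<times> (real ^ 'd) \<times> real) measure) \<rightarrow>\<^sub>M prob_algebra borel"
    by (simp add: borel_prod[symmetric])
  then show ?thesis
    by (rule measurable_distr_prob_space2) (rule chain_step_measurable)
qed

lemma chain_law_measurable [measurable]: "chain_law K \<alpha> l k \<in> borel \<rightarrow>\<^sub>M prob_algebra borel"
proof (induction k)
  case 0
  have "chain_law K \<alpha> l 0 = return borel" by auto
  then show ?case by simp
next
  case (Suc k)
  have "chain_law K \<alpha> l (Suc k) =
      (\<lambda>z. chain_law K \<alpha> l k z \<bind> (\<lambda>w. distr (K (fst (snd w))) borel (chain_step \<alpha> l w)))" by auto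
  then show ?case
    using measurable_bind_prob_space[OF Suc.IH chain_kernel_measurable] by simp
qed

lemma prob_space_kernel: "prob_space (K \<theta>)" and sets_kernel: "sets (K \<theta>) = sets borel"
  using measurable_space[OF kernel_measurable, of \<theta>] by (auto simp: space_prob_algebra)

lemma prob_space_chain_law: "prob_space (chain_law K \<alpha> l k z)"
  and sets_chain_law [measurable_cong]: "sets (chain_law K \<alpha> l k z) = sets borel"
  using measurable_space[OF chain_law_measurable, of z] by (auto simp: space_prob_algebra)

lemma chain_step_measurable_snd: "chain_step \<alpha> l w \<in> borel \<rightarrow>\<^sub>M borel"
  using chain_step_measurable by simp

lemma nn_integral_chain_law_0:
  "f \<in> borel_measurable borel \<Longrightarrow> (\<integral>\<^sup>+w. f w \<partial>chain_law K \<alpha> l 0 z) = f z"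
  by (simp add: nn_integral_return)

lemma nn_integral_chain_law_Suc:
  assumes f: "f \<in> borel_measurable borel"
  shows "(\<integral>\<^sup>+w. f w \<partial>chain_law K \<alpha> l (Suc k) z)
    = (\<integral>\<^sup>+w. (\<integral>\<^sup>+x. f (chain_step \<alpha> l w x) \<partial>K (fst (snd w))) \<partial>chain_law K \<alpha> l k z)"
proof -
  have "(\<lambda>w. distr (K (fst (snd w))) borel (chain_step \<alpha> l w))
      \<in> chain_law K \<alpha> l k z \<rightarrow>\<^sub>M subprob_algebra borel"
    using measurable_prob_algebraD[OF chain_kernel_measurable]
    by (simp cong: measurable_cong_sets add: sets_chain_law)
  then show ?thesis
    using f by (auto simp: nn_integral_bind intro!: nn_integral_cong nn_integral_distr
      simp: measurable_cong_sets[OF sets_kernel refl] chain_step_measurable_snd)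
qed

lemma AE_chain_law_fst: "AE w in chain_law K \<alpha> l k z. fst w = fst z"
proof -
  have [measurable]: "fst \<in> (borel :: ((real ^ 'd) \<times> (real ^ 'd) \<times> real) measure) \<rightarrow>\<^sub>M borel"
    by (simp add: borel_prod[symmetric])
  have "(\<integral>\<^sup>+w. indicator {w. fst w \<noteq> fst z} w \<partial>chain_law K \<alpha> l k z) = 0"
  proof (induction k)
    case 0
    show ?case by (subst nn_integral_chain_law_0) auto
  next
    case (Suc k)
    show ?case
      by (subst nn_integral_chain_law_Suc)
        (use Suc in \<open>auto simp: chain_step_def indicator_def prob_space.emeasure_space_1[OF prob_space_kernel]\<close>)
  qed
  then show ?thesis
    by (subst (asm) nn_integral_0_iff_AE) (auto simp: indicator_def split: if_splits)
qed

lemma AE_chain_law_weight_ge: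
  assumes "0 \<le> \<alpha>" and l: "\<And>u. 0 \<le> l u"
  shows "AE w in chain_law K \<alpha> l k (\<theta>\<^sub>0, \<theta>\<^sub>0, 1). 1 \<le> snd (snd w)"
proof -
  have [measurable]: "(\<lambda>w. snd (snd w)) \<in> (borel :: ((real ^ 'd) \<times> (real ^ 'd) \<times> real) measure) \<rightarrow>\<^sub>M borel"
    by (simp add: borel_prod[symmetric])
  have "(\<integral>\<^sup>+w. indicator {w. \<not> 1 \<le> snd (snd w)} w \<partial>chain_law K \<alpha> l k (\<theta>\<^sub>0, \<theta>\<^sub>0, 1)) = 0"
  proof (induction k)
    case 0
    show ?case by (subst nn_integral_chain_law_0) auto
  next
    case (Suc k)
    have grow: "1 \<le> p * (1 + \<alpha> * l u)" if "1 \<le> p" for p u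
      using that assms mult_mono[of 1 p 1 "1 + \<alpha> * l u"] by simp
    have "(\<integral>\<^sup>+w. indicator {w. \<not> 1 \<le> snd (snd w)} w \<partial>chain_law K \<alpha> l (Suc k) (\<theta>\<^sub>0, \<theta>\<^sub>0, 1))
      \<le> (\<integral>\<^sup>+w. (\<integral>\<^sup>+x. indicator {w. \<not> 1 \<le> snd (snd w)} w \<partial>K (fst (snd w))) \<partial>chain_law K \<alpha> l k (\<theta>\<^sub>0, \<theta>\<^sub>0, 1))"
      by (subst nn_integral_chain_law_Suc)
        (auto simp: chain_step_def indicator_def intro!: nn_integral_mono dest: grow)
    also have "\<dots> = 0"
      using Suc by (simp add: prob_space.emeasure_space_1[OF prob_space_kernel])
    finally show ?case by simp
  qed
  then show ?thesis
    by (subst (asm) nn_integral_0_iff_AE) (auto simp: indicator_def split: if_splits)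
qed

lemma nn_integral_weight_square_mono:
  assumes "0 \<le> \<alpha>" and l: "\<And>u. 0 \<le> l u" and "j \<le> k"
  shows "(\<integral>\<^sup>+w. ennreal ((snd (snd w))\<^sup>2) \<partial>chain_law K \<alpha> l j z)
    \<le> (\<integral>\<^sup>+w. ennreal ((snd (snd w))\<^sup>2) \<partial>chain_law K \<alpha> l k z)"
  using \<open>j \<le> k\<close>
proof (induction k rule: dec_induct)
  case (step k)
  have [measurable]: "(\<lambda>w. snd (snd w)) \<in> (borel :: ((real ^ 'd) \<times> (real ^ 'd) \<times> real) measure) \<rightarrow>\<^sub>M borel"
    by (simp add: borel_prod[symmetric])
  have grow: "p\<^sup>2 \<le> (p * (1 + \<alpha> * l u))\<^sup>2" for p u
  proof -
    have "1 \<le> (1 + \<alpha> * l u)\<^sup>2" using assms by (intro one_le_power) simp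
    then show ?thesis
      using mult_left_mono[of 1 "(1 + \<alpha> * l u)\<^sup>2" "p\<^sup>2"] by (simp add: power_mult_distrib)
  qed
  have "(\<integral>\<^sup>+w. ennreal ((snd (snd w))\<^sup>2) \<partial>chain_law K \<alpha> l k z)
    = (\<integral>\<^sup>+w. (\<integral>\<^sup>+x. ennreal ((snd (snd w))\<^sup>2) \<partial>K (fst (snd w))) \<partial>chain_law K \<alpha> l k z)"
    by (simp add: prob_space.emeasure_space_1[OF prob_space_kernel])
  also have "\<dots> \<le> (\<integral>\<^sup>+w. ennreal ((snd (snd w))\<^sup>2) \<partial>chain_law K \<alpha> l (Suc k) z)"
    by (subst nn_integral_chain_law_Suc)
      (auto simp: chain_step_def prob_space.emeasure_space_1[OF prob_space_kernel]
        intro!: nn_integral_mono ennreal_leI grow)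
  finally show ?case using step.IH by (rule order_trans[rotated])
qed simp

end

section \<open>The error of the chain against the flow\<close>

text \<open>The estimate for a single starting point \<open>\<theta>\<^sub>0\<close>: the weights \<open>l\<close> are the Lipschitz constants between the
  region \<open>S\<close> of the iterates and the region \<open>T\<close> of the flow, and \<open>D\<close> is the Lipschitz constant in \<open>T\<close>.\<close>

locale chain_near_flow = weighted_chain K \<alpha> l
  for K :: "real ^ 'd \<Rightarrow> (real ^ 'd) measure" and \<alpha> l +
  fixes N :: nat and \<theta>\<^sub>0 :: "real ^ 'd" and S T :: "(real ^ 'd) set" and y :: "real \<Rightarrow> real ^ 'd"
    and Q :: "real ^ 'd ^ 'd" and R :: "real ^ 'd \<Rightarrow> real" and D K\<^sub>1 K\<^sub>2 :: real
  assumes step_pos: "0 < \<alpha>" and weight_nonneg: "0 \<le> l u"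
    and Q: "pos_def_sym Q"
    and flow: "flow_solution (mean_field K) T \<theta>\<^sub>0 (real N * \<alpha>) y"
    and stay: "k \<le> N \<Longrightarrow> AE w in chain_law K \<alpha> l k (\<theta>\<^sub>0, \<theta>\<^sub>0, 1). fst (snd w) \<in> S"
    and mean_exists: "\<theta> \<in> S \<union> T \<Longrightarrow> integrable (K \<theta>) (\<lambda>x. x)"
    and Lipschitz_S: "\<theta> \<in> S \<Longrightarrow> \<theta>' \<in> T \<Longrightarrow>
      qnorm Q (mean_field K \<theta> - mean_field K \<theta>') \<le> l (\<theta>\<^sub>0, \<theta>) * qnorm Q (\<theta> - \<theta>')"
    and D_nonneg: "0 \<le> D"
    and Lipschitz_T: "\<theta> \<in> T \<Longrightarrow> \<theta>' \<in> T \<Longrightarrow>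
      qnorm Q (mean_field K \<theta> - mean_field K \<theta>') \<le> D * qnorm Q (\<theta> - \<theta>')"
    and growth_consts: "0 \<le> K\<^sub>1" "0 \<le> K\<^sub>2"
    and R_nonneg: "\<theta> \<in> S \<union> T \<Longrightarrow> 0 \<le> R \<theta>"
    and moment: "\<theta> \<in> S \<union> T \<Longrightarrow> (\<integral>\<^sup>+x. ennreal ((qnorm Q x)\<^sup>2) \<partial>K \<theta>) \<le> ennreal ((R \<theta>)\<^sup>2)"
    and growth: "\<theta> \<in> S \<union> T \<Longrightarrow> \<theta>' \<in> S \<union> T \<Longrightarrow>
      (R \<theta>)\<^sup>2 \<le> K\<^sub>1\<^sup>2 * (qnorm Q (\<theta> - \<theta>'))\<^sup>2 + K\<^sub>2\<^sup>2 * (R \<theta>')\<^sup>2"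
    and speed_measurable: "(\<lambda>t. R (y t)) \<in> borel_measurable (lebesgue_on {0..real N * \<alpha>})"
begin

abbreviation law :: "nat \<Rightarrow> ((real ^ 'd) \<times> (real ^ 'd) \<times> real) measure"
  where "law k \<equiv> chain_law K \<alpha> l k (\<theta>\<^sub>0, \<theta>\<^sub>0, 1)"

lemma state_projections_measurable [measurable]:
  "(\<lambda>w. fst (snd w)) \<in> (borel :: ((real ^ 'd) \<times> (real ^ 'd) \<times> real) measure) \<rightarrow>\<^sub>M borel"
  "(\<lambda>w. snd (snd w)) \<in> (borel :: ((real ^ 'd) \<times> (real ^ 'd) \<times> real) measure) \<rightarrow>\<^sub>M borel"
  by (simp_all add: borel_prod[symmetric])

lemma flow_in_T: "t \<in> {0..real N * \<alpha>} \<Longrightarrow> y t \<in> T"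
  using flow unfolding flow_solution_def by blast

lemma flow_start: "y 0 = \<theta>\<^sub>0"
  using flow_solution_start[OF flow] step_pos by simp

lemma start_in_T: "\<theta>\<^sub>0 \<in> T"
  using flow_in_T[of 0] step_pos by (simp add: flow_start)

definition defect :: "nat \<Rightarrow> real"
  where "defect i = D * integral {real i * \<alpha>..(real i + 1) * \<alpha>} (\<lambda>t. ((real i + 1) * \<alpha> - t) * R (y t))"

text \<open>The mean field is bounded by the root mean square of the increment, hence by \<open>R\<close>; this is the speed
  in the Euler step estimate. The growth condition compares \<open>R\<close> along the flow with its value at the
  start, which makes it bounded.\<close>

lemma euler_defect:
  assumes "i < N"
  shows "qnorm Q (y ((real i + 1) * \<alpha>) - y (real i * \<alpha>) - \<alpha> *\<^sub>R mean_field K (y (real i * \<alpha>))) \<le> defect i"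
proof -
  have "continuous_on {0..real N * \<alpha>} (\<lambda>t. K\<^sub>1\<^sup>2 * (qnorm Q (y t - \<theta>\<^sub>0))\<^sup>2 + K\<^sub>2\<^sup>2 * (R \<theta>\<^sub>0)\<^sup>2)"
    by (intro continuous_intros flow_solution_continuous[OF flow])
  then have "bdd_above ((\<lambda>t. K\<^sub>1\<^sup>2 * (qnorm Q (y t - \<theta>\<^sub>0))\<^sup>2 + K\<^sub>2\<^sup>2 * (R \<theta>\<^sub>0)\<^sup>2) ` {0..real N * \<alpha>})"
    by (intro bounded_imp_bdd_above compact_imp_bounded compact_continuous_image) auto
  then obtain B where B: "\<And>t. t \<in> {0..real N * \<alpha>} \<Longrightarrow>
      K\<^sub>1\<^sup>2 * (qnorm Q (y t - \<theta>\<^sub>0))\<^sup>2 + K\<^sub>2\<^sup>2 * (R \<theta>\<^sub>0)\<^sup>2 \<le> B"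
    unfolding bdd_above_def by blast
  have bound: "R (y t) \<le> 1 + B" if t: "t \<in> {0..real N * \<alpha>}" for t
  proof -
    have "(R (y t))\<^sup>2 \<le> B"
      using growth[of "y t" \<theta>\<^sub>0] B[OF t] flow_in_T[OF t] start_in_T by auto
    moreover have "R (y t) \<le> 1 + (R (y t))\<^sup>2"
      using zero_le_power2[of "R (y t) - 1"] zero_le_power2[of "R (y t)"]
      unfolding power2_diff power_one mult_1_right by linarith
    ultimately show ?thesis by simp
  qed
  have speed: "qnorm Q (mean_field K (y t)) \<le> R (y t)" if "t \<in> {0..real N * \<alpha>}" for t
    unfolding mean_field_def using flow_in_T[OF that]
    by (intro nn_integral_noise_square_le(2) prob_space_kernel sets_kernel Q mean_exists moment R_nonneg) auto
  have "real (Suc i) * \<alpha> \<le> real N * \<alpha>"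
    using assms step_pos by (intro mult_right_mono) auto
  then have "(real i + 1) * \<alpha> \<le> real N * \<alpha>" by (simp add: add.commute)
  moreover have "real i * \<alpha> \<le> (real i + 1) * \<alpha>" using step_pos by simp
  ultimately show ?thesis
    using euler_step_defect_le[OF Q D_nonneg Lipschitz_T flow speed speed_measurable bound,
        of "real i * \<alpha>" "(real i + 1) * \<alpha>"] step_pos
    by (simp add: defect_def algebra_simps)
qed

lemma defect_nonneg: "i < N \<Longrightarrow> 0 \<le> defect i"
  using euler_defect qnorm_nonneg[OF Q] by (meson order_trans)

definition displacement_bound :: "nat \<Rightarrow> real"
  where "displacement_bound k = real k * \<alpha> * K\<^sub>2 * R \<theta>\<^sub>0 * exp (\<alpha> * K\<^sub>1 * real k)"

lemma displacement_bound_nonneg: "0 \<le> displacement_bound k"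
  using step_pos growth_consts R_nonneg[of \<theta>\<^sub>0] start_in_T by (simp add: displacement_bound_def)

text \<open>Each step adds at most \<open>\<alpha> R \<le> \<alpha> (K\<^sub>1 \<parallel>\<theta> - \<theta>\<^sub>0\<parallel> + K\<^sub>2 R \<theta>\<^sub>0)\<close> in root mean square, so the bounds need to
  satisfy \<open>(1 + \<alpha> K\<^sub>1) d\<^sub>k + \<alpha> K\<^sub>2 R \<theta>\<^sub>0 \<le> d\<^sub>k\<^sub>+\<^sub>1\<close>; the exponential in their definition absorbs the
  factors \<open>1 + \<alpha> K\<^sub>1\<close>.\<close>

lemma second_moment_displacement:
  assumes "k \<le> N"
  shows "(\<integral>\<^sup>+w. ennreal ((qnorm Q (fst (snd w) - \<theta>\<^sub>0))\<^sup>2) \<partial>law k) \<le> ennreal ((displacement_bound k)\<^sup>2)"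
  using assms
proof (induction k)
  case 0
  show ?case by (subst nn_integral_chain_law_0) (auto simp: displacement_bound_def)
next
  case (Suc k)
  let ?q = "\<lambda>w :: (real ^ 'd) \<times> (real ^ 'd) \<times> real. qnorm Q (fst (snd w) - \<theta>\<^sub>0)"
  have R0: "0 \<le> R \<theta>\<^sub>0" using R_nonneg start_in_T by simp
  have "(\<integral>\<^sup>+w. ennreal ((?q w)\<^sup>2) \<partial>law (Suc k))
      = (\<integral>\<^sup>+w. (\<integral>\<^sup>+x. ennreal ((qnorm Q ((fst (snd w) - \<theta>\<^sub>0) + \<alpha> *\<^sub>R x))\<^sup>2) \<partial>K (fst (snd w))) \<partial>law k)"
    by (subst nn_integral_chain_law_Suc) (auto simp: chain_step_def algebra_simps)
  also have "\<dots> \<le> (\<integral>\<^sup>+w. ennreal (((1 + \<alpha> * K\<^sub>1) * ?q w + \<alpha> * (K\<^sub>2 * R \<theta>\<^sub>0))\<^sup>2) \<partial>law k)"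
  proof (rule nn_integral_mono_AE)
    have "AE w in law k. fst (snd w) \<in> S" using stay Suc.prems by simp
    then show "AE w in law k. (\<integral>\<^sup>+x. ennreal ((qnorm Q ((fst (snd w) - \<theta>\<^sub>0) + \<alpha> *\<^sub>R x))\<^sup>2) \<partial>K (fst (snd w)))
        \<le> ennreal (((1 + \<alpha> * K\<^sub>1) * ?q w + \<alpha> * (K\<^sub>2 * R \<theta>\<^sub>0))\<^sup>2)"
    proof eventually_elim
      case (elim w)
      let ?\<theta> = "fst (snd w)"
      have q: "0 \<le> ?q w" by (rule qnorm_nonneg[OF Q])
      have "(R ?\<theta>)\<^sup>2 \<le> K\<^sub>1\<^sup>2 * (?q w)\<^sup>2 + K\<^sub>2\<^sup>2 * (R \<theta>\<^sub>0)\<^sup>2"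
        using growth[of ?\<theta> \<theta>\<^sub>0] elim start_in_T by simp
      also have "\<dots> \<le> (K\<^sub>1 * ?q w + K\<^sub>2 * R \<theta>\<^sub>0)\<^sup>2"
        using q R0 growth_consts by (simp add: power2_sum power_mult_distrib)
      finally have R_le: "R ?\<theta> \<le> K\<^sub>1 * ?q w + K\<^sub>2 * R \<theta>\<^sub>0"
        by (rule power2_le_imp_le) (use q R0 growth_consts in simp)
      have "(\<integral>\<^sup>+x. ennreal ((qnorm Q ((?\<theta> - \<theta>\<^sub>0) + \<alpha> *\<^sub>R x))\<^sup>2) \<partial>K ?\<theta>) \<le> ennreal ((?q w + \<alpha> * R ?\<theta>)\<^sup>2)"
        using elim step_pos
        by (intro nn_integral_displacement_square_le prob_space_kernel sets_kernel Q moment R_nonneg) auto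
      also have "\<dots> \<le> ennreal (((1 + \<alpha> * K\<^sub>1) * ?q w + \<alpha> * (K\<^sub>2 * R \<theta>\<^sub>0))\<^sup>2)"
      proof (intro ennreal_leI power_mono)
        have "\<alpha> * R ?\<theta> \<le> \<alpha> * (K\<^sub>1 * ?q w + K\<^sub>2 * R \<theta>\<^sub>0)"
          using R_le step_pos by (intro mult_left_mono) auto
        then show "?q w + \<alpha> * R ?\<theta> \<le> (1 + \<alpha> * K\<^sub>1) * ?q w + \<alpha> * (K\<^sub>2 * R \<theta>\<^sub>0)"
          by (simp add: algebra_simps)
        show "0 \<le> ?q w + \<alpha> * R ?\<theta>" using q step_pos R_nonneg[of ?\<theta>] elim by simp
      qed
      finally show ?case .
    qed
  qed
  also have "\<dots> \<le> ennreal (((1 + \<alpha> * K\<^sub>1) * displacement_bound k + \<alpha> * (K\<^sub>2 * R \<theta>\<^sub>0))\<^sup>2)"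
    using Suc step_pos growth_consts R0
    by (intro nn_integral_affine_square_le prob_space_chain_law displacement_bound_nonneg) auto
  also have "\<dots> \<le> ennreal ((displacement_bound (Suc k))\<^sup>2)"
  proof (intro ennreal_leI power_mono)
    have "(1 + \<alpha> * K\<^sub>1) * displacement_bound k \<le> exp (\<alpha> * K\<^sub>1) * displacement_bound k"
      by (intro mult_right_mono exp_ge_add_one_self displacement_bound_nonneg)
    also have "\<dots> = real k * (\<alpha> * (K\<^sub>2 * R \<theta>\<^sub>0)) * exp (\<alpha> * K\<^sub>1 * real (Suc k))"
      by (simp add: displacement_bound_def algebra_simps exp_add)
    finally have "(1 + \<alpha> * K\<^sub>1) * displacement_bound k
        \<le> real k * (\<alpha> * (K\<^sub>2 * R \<theta>\<^sub>0)) * exp (\<alpha> * K\<^sub>1 * real (Suc k))" .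
    moreover have "\<alpha> * (K\<^sub>2 * R \<theta>\<^sub>0) * 1 \<le> \<alpha> * (K\<^sub>2 * R \<theta>\<^sub>0) * exp (\<alpha> * K\<^sub>1 * real (Suc k))"
      using step_pos growth_consts R0 by (intro mult_left_mono) auto
    ultimately show "(1 + \<alpha> * K\<^sub>1) * displacement_bound k + \<alpha> * (K\<^sub>2 * R \<theta>\<^sub>0) \<le> displacement_bound (Suc k)"
      by (simp add: displacement_bound_def algebra_simps)
    show "0 \<le> (1 + \<alpha> * K\<^sub>1) * displacement_bound k + \<alpha> * (K\<^sub>2 * R \<theta>\<^sub>0)"
      using step_pos growth_consts R0 displacement_bound_nonneg[of k] by simp
  qed
  finally show ?case .
qed

text \<open>A bound, uniform in time, on the mean of \<open>\<alpha>\<^sup>2 (R \<theta>)\<^sup>2\<close> at the iterate \<open>\<theta>\<close>. As \<open>R\<close> may fail to be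
  measurable, it goes through the growth condition, whose right-hand side is measurable.\<close>

definition noise_bound :: real
  where "noise_bound = \<alpha>\<^sup>2 * (K\<^sub>1\<^sup>2 * (displacement_bound N)\<^sup>2 + K\<^sub>2\<^sup>2 * (R \<theta>\<^sub>0)\<^sup>2)"

lemma noise_bound_nonneg: "0 \<le> noise_bound"
  by (simp add: noise_bound_def)

lemma sqrt_noise_bound: "sqrt (real N * noise_bound) = C2 K\<^sub>1 K\<^sub>2 \<alpha> N R \<theta>\<^sub>0"
proof (rule real_sqrt_unique)
  have "(exp (\<alpha> * K\<^sub>1 * real N))\<^sup>2 = exp (2 * K\<^sub>1 * real N * \<alpha>)"
    by (simp add: exp_double[symmetric] algebra_simps)
  moreover have "0 \<le> 1 + (K\<^sub>1 * real N * \<alpha>)\<^sup>2 * exp (2 * K\<^sub>1 * real N * \<alpha>)" by simp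
  ultimately show "(C2 K\<^sub>1 K\<^sub>2 \<alpha> N R \<theta>\<^sub>0)\<^sup>2 = real N * noise_bound"
    unfolding C2_def noise_bound_def displacement_bound_def power_mult_distrib
    by (simp add: algebra_simps)
  show "0 \<le> C2 K\<^sub>1 K\<^sub>2 \<alpha> N R \<theta>\<^sub>0"
    using growth_consts R_nonneg[of \<theta>\<^sub>0] start_in_T by (simp add: C2_def)
qed

lemma C1_eq_sum_defects: "C1 (\<lambda>_ _. D) \<alpha> N R y = (\<Sum>i<N. defect i)"
  by (simp add: C1_def defect_def)

text \<open>The next iterate splits into a deterministic part, whose distance from the flow is at most
  \<open>1 + \<alpha> l\<close> times the present error plus the defect, and centred noise, which is orthogonal to it.
  Dividing by the weight cancels the factor \<open>1 + \<alpha> l\<close>, and can only decrease the other two terms.\<close>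

lemma one_step_weighted_error:
  assumes k: "k < N" and \<theta>: "\<theta> \<in> S" and p: "1 \<le> p"
  shows "(\<integral>\<^sup>+x. ennreal ((qnorm Q (\<theta> + \<alpha> *\<^sub>R x - y (real (Suc k) * \<alpha>)) / (p * (1 + \<alpha> * l (\<theta>\<^sub>0, \<theta>))))\<^sup>2) \<partial>K \<theta>)
    \<le> ennreal ((qnorm Q (\<theta> - y (real k * \<alpha>)) / p + defect k)\<^sup>2 + \<alpha>\<^sup>2 * (R \<theta>)\<^sup>2)"
proof -
  note [measurable_cong] = sets_kernel
  define F where "F = mean_field K"
  define g where "g = 1 + \<alpha> * l (\<theta>\<^sub>0, \<theta>)"
  define e where "e = \<theta> - y (real k * \<alpha>)"
  define r where "r = y (real (Suc k) * \<alpha>) - y (real k * \<alpha>) - \<alpha> *\<^sub>R F (y (real k * \<alpha>))"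
  define v where "v = e + \<alpha> *\<^sub>R (F \<theta> - F (y (real k * \<alpha>))) - r"
  have g: "1 \<le> g" using step_pos weight_nonneg by (simp add: g_def)
  have pg: "1 \<le> p * g" using mult_mono[OF p g] p by simp
  have r: "qnorm Q r \<le> defect k"
    using euler_defect[OF k] by (simp add: r_def F_def add.commute)
  have yT: "y (real k * \<alpha>) \<in> T"
    using k step_pos by (intro flow_in_T) (auto intro: mult_right_mono)
  have "qnorm Q v \<le> qnorm Q e + qnorm Q (\<alpha> *\<^sub>R (F \<theta> - F (y (real k * \<alpha>)))) + qnorm Q r"
    using qnorm_triangle[OF Q, of "e + \<alpha> *\<^sub>R (F \<theta> - F (y (real k * \<alpha>)))" "- r"]
      qnorm_triangle[OF Q, of e "\<alpha> *\<^sub>R (F \<theta> - F (y (real k * \<alpha>)))"]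
    by (simp add: v_def qnorm_minus)
  also have "qnorm Q (\<alpha> *\<^sub>R (F \<theta> - F (y (real k * \<alpha>)))) \<le> \<alpha> * (l (\<theta>\<^sub>0, \<theta>) * qnorm Q e)"
    using Lipschitz_S[OF \<theta> yT] step_pos by (simp add: qnorm_scaleR F_def e_def)
  finally have v_le: "qnorm Q v \<le> g * qnorm Q e + defect k"
    using r by (simp add: g_def algebra_simps)
  have "\<theta> + \<alpha> *\<^sub>R x - y (real (Suc k) * \<alpha>) = v + \<alpha> *\<^sub>R (x - (LINT x|K \<theta>. x))" for x
    by (simp add: v_def e_def r_def F_def mean_field_def algebra_simps)
  then have "(\<integral>\<^sup>+x. ennreal ((qnorm Q (\<theta> + \<alpha> *\<^sub>R x - y (real (Suc k) * \<alpha>)) / (p * g))\<^sup>2) \<partial>K \<theta>)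
      = (\<integral>\<^sup>+x. ennreal ((qnorm Q (v + \<alpha> *\<^sub>R (x - (LINT x|K \<theta>. x))))\<^sup>2) * ennreal (1 / (p * g)\<^sup>2) \<partial>K \<theta>)"
    by (simp add: ennreal_mult[symmetric] power_divide)
  also have "\<dots> = (\<integral>\<^sup>+x. ennreal ((qnorm Q (v + \<alpha> *\<^sub>R (x - (LINT x|K \<theta>. x))))\<^sup>2) \<partial>K \<theta>) * ennreal (1 / (p * g)\<^sup>2)"
    by (rule nn_integral_multc) measurable
  also have "\<dots> \<le> ennreal ((qnorm Q v)\<^sup>2 + \<alpha>\<^sup>2 * (R \<theta>)\<^sup>2) * ennreal (1 / (p * g)\<^sup>2)"
    using \<theta> by (intro mult_right_mono nn_integral_noise_square_le prob_space_kernel sets_kernel Q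
        mean_exists moment R_nonneg) auto
  also have "\<dots> = ennreal ((qnorm Q v / (p * g))\<^sup>2 + \<alpha>\<^sup>2 * (R \<theta>)\<^sup>2 / (p * g)\<^sup>2)"
    by (simp add: ennreal_mult[symmetric] power_divide add_divide_distrib del: ennreal_plus)
  also have "\<dots> \<le> ennreal ((qnorm Q e / p + defect k)\<^sup>2 + \<alpha>\<^sup>2 * (R \<theta>)\<^sup>2)"
  proof (intro ennreal_leI add_mono power_mono)
    have "qnorm Q v / (p * g) \<le> (g * qnorm Q e + defect k) / (p * g)"
      using v_le pg by (intro divide_right_mono) auto
    also have "\<dots> = qnorm Q e / p + defect k / (p * g)"
      using g by (simp add: add_divide_distrib)
    also have "defect k / (p * g) \<le> defect k"
      using defect_nonneg[OF k] pg by (simp add: divide_le_eq mult_left_mono[of 1 "p * g" "defect k", simplified])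
    finally show "qnorm Q v / (p * g) \<le> qnorm Q e / p + defect k" by simp
    show "0 \<le> qnorm Q v / (p * g)" using pg qnorm_nonneg[OF Q] by simp
    have "1 \<le> (p * g)\<^sup>2" using pg by (rule one_le_power)
    then show "\<alpha>\<^sup>2 * (R \<theta>)\<^sup>2 / (p * g)\<^sup>2 \<le> \<alpha>\<^sup>2 * (R \<theta>)\<^sup>2"
      by (simp add: divide_le_eq mult_left_mono[of 1 "(p * g)\<^sup>2", simplified])
  qed
  finally show ?thesis by (simp add: g_def e_def)
qed

text \<open>The form of the bound is preserved by one step because of the elementary inequality
  \<open>(a + \<delta> + sqrt b)\<^sup>2 + c \<le> (a + \<delta> + sqrt (b + c))\<^sup>2\<close> for nonnegative numbers.\<close>

lemma weighted_error_second_moment: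
  assumes "k \<le> N"
  shows "(\<integral>\<^sup>+w. ennreal ((qnorm Q (fst (snd w) - y (real k * \<alpha>)) / snd (snd w))\<^sup>2) \<partial>law k)
    \<le> ennreal (((\<Sum>i<k. defect i) + sqrt (real k * noise_bound))\<^sup>2)"
  using assms
proof (induction k)
  case 0
  show ?case by (subst nn_integral_chain_law_0) (auto simp: flow_start)
next
  case (Suc k)
  let ?E = "\<lambda>w :: (real ^ 'd) \<times> (real ^ 'd) \<times> real. qnorm Q (fst (snd w) - y (real k * \<alpha>)) / snd (snd w)"
  let ?q = "\<lambda>w :: (real ^ 'd) \<times> (real ^ 'd) \<times> real. qnorm Q (fst (snd w) - \<theta>\<^sub>0)"
  let ?A = "\<Sum>i<k. defect i" and ?b = "sqrt (real k * noise_bound)"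
  have k: "k < N" using Suc.prems by simp
  have A: "0 \<le> ?A" using k by (intro sum_nonneg defect_nonneg) auto
  have \<delta>: "0 \<le> defect k" using k by (rule defect_nonneg)
  have "(\<integral>\<^sup>+w. ennreal ((qnorm Q (fst (snd w) - y (real (Suc k) * \<alpha>)) / snd (snd w))\<^sup>2) \<partial>law (Suc k))
    = (\<integral>\<^sup>+w. (\<integral>\<^sup>+x. ennreal ((qnorm Q (fst (snd w) + \<alpha> *\<^sub>R x - y (real (Suc k) * \<alpha>))
        / (snd (snd w) * (1 + \<alpha> * l (fst w, fst (snd w)))))\<^sup>2) \<partial>K (fst (snd w))) \<partial>law k)"
    by (subst nn_integral_chain_law_Suc) (auto simp: chain_step_def)
  also have "\<dots> \<le> (\<integral>\<^sup>+w. ennreal ((1 * ?E w + defect k)\<^sup>2)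
      + (ennreal (\<alpha>\<^sup>2 * K\<^sub>1\<^sup>2) * ennreal ((?q w)\<^sup>2) + ennreal (\<alpha>\<^sup>2 * (K\<^sub>2\<^sup>2 * (R \<theta>\<^sub>0)\<^sup>2))) \<partial>law k)"
  proof (rule nn_integral_mono_AE)
    have "AE w in law k. fst (snd w) \<in> S" using stay k by simp
    moreover have "AE w in law k. fst w = \<theta>\<^sub>0" using AE_chain_law_fst[of "(\<theta>\<^sub>0, \<theta>\<^sub>0, 1)" k] by simp
    moreover have "AE w in law k. 1 \<le> snd (snd w)"
      using step_pos weight_nonneg by (intro AE_chain_law_weight_ge) auto
    ultimately show "AE w in law k. (\<integral>\<^sup>+x. ennreal ((qnorm Q (fst (snd w) + \<alpha> *\<^sub>R x - y (real (Suc k) * \<alpha>))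
        / (snd (snd w) * (1 + \<alpha> * l (fst w, fst (snd w)))))\<^sup>2) \<partial>K (fst (snd w)))
      \<le> ennreal ((1 * ?E w + defect k)\<^sup>2)
        + (ennreal (\<alpha>\<^sup>2 * K\<^sub>1\<^sup>2) * ennreal ((?q w)\<^sup>2) + ennreal (\<alpha>\<^sup>2 * (K\<^sub>2\<^sup>2 * (R \<theta>\<^sub>0)\<^sup>2)))"
    proof eventually_elim
      case (elim w)
      have "\<alpha>\<^sup>2 * (R (fst (snd w)))\<^sup>2 \<le> \<alpha>\<^sup>2 * (K\<^sub>1\<^sup>2 * (?q w)\<^sup>2 + K\<^sub>2\<^sup>2 * (R \<theta>\<^sub>0)\<^sup>2)"
        using growth[of "fst (snd w)" \<theta>\<^sub>0] elim start_in_T by (intro mult_left_mono) auto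
      then have "ennreal ((?E w + defect k)\<^sup>2 + \<alpha>\<^sup>2 * (R (fst (snd w)))\<^sup>2)
          \<le> ennreal ((?E w + defect k)\<^sup>2 + (\<alpha>\<^sup>2 * K\<^sub>1\<^sup>2 * (?q w)\<^sup>2 + \<alpha>\<^sup>2 * (K\<^sub>2\<^sup>2 * (R \<theta>\<^sub>0)\<^sup>2)))"
        by (intro ennreal_leI) (simp add: algebra_simps)
      also have "\<dots> = ennreal ((1 * ?E w + defect k)\<^sup>2)
        + (ennreal (\<alpha>\<^sup>2 * K\<^sub>1\<^sup>2) * ennreal ((?q w)\<^sup>2) + ennreal (\<alpha>\<^sup>2 * (K\<^sub>2\<^sup>2 * (R \<theta>\<^sub>0)\<^sup>2)))"
        by (simp add: ennreal_mult[symmetric])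
      finally show ?case
        using one_step_weighted_error[OF k elim(1,3)] elim(2) by (simp add: order_trans)
    qed
  qed
  also have "\<dots> = (\<integral>\<^sup>+w. ennreal ((1 * ?E w + defect k)\<^sup>2) \<partial>law k)
      + (ennreal (\<alpha>\<^sup>2 * K\<^sub>1\<^sup>2) * (\<integral>\<^sup>+w. ennreal ((?q w)\<^sup>2) \<partial>law k) + ennreal (\<alpha>\<^sup>2 * (K\<^sub>2\<^sup>2 * (R \<theta>\<^sub>0)\<^sup>2)))"
    by (simp add: nn_integral_add nn_integral_cmult prob_space.emeasure_space_1[OF prob_space_chain_law])
  also have "\<dots> \<le> ennreal ((1 * (?A + ?b) + defect k)\<^sup>2)
      + (ennreal (\<alpha>\<^sup>2 * K\<^sub>1\<^sup>2) * ennreal ((displacement_bound N)\<^sup>2) + ennreal (\<alpha>\<^sup>2 * (K\<^sub>2\<^sup>2 * (R \<theta>\<^sub>0)\<^sup>2)))"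
  proof (intro add_mono mult_left_mono order_refl)
    show "(\<integral>\<^sup>+w. ennreal ((1 * ?E w + defect k)\<^sup>2) \<partial>law k) \<le> ennreal ((1 * (?A + ?b) + defect k)\<^sup>2)"
      using Suc A \<delta> noise_bound_nonneg
      by (intro nn_integral_affine_square_le prob_space_chain_law) auto
    have "displacement_bound k \<le> displacement_bound N"
      unfolding displacement_bound_def using k step_pos growth_consts R_nonneg[of \<theta>\<^sub>0] start_in_T
      by (intro mult_mono) (auto intro!: mult_nonneg_nonneg mult_left_mono)
    then show "(\<integral>\<^sup>+w. ennreal ((?q w)\<^sup>2) \<partial>law k) \<le> ennreal ((displacement_bound N)\<^sup>2)"
      using second_moment_displacement[of k] k displacement_bound_nonneg[of k]
      by (auto intro: order_trans ennreal_leI power_mono)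
  qed simp
  also have "\<dots> = ennreal ((?A + defect k + ?b)\<^sup>2 + noise_bound)"
    by (simp add: ennreal_mult[symmetric] noise_bound_def algebra_simps)
  also have "\<dots> \<le> ennreal ((?A + defect k + sqrt (real (Suc k) * noise_bound))\<^sup>2)"
  proof (rule ennreal_leI)
    have "?b \<le> sqrt (real (Suc k) * noise_bound)"
      using noise_bound_nonneg by (simp add: mult_right_mono)
    then have "(?A + defect k) * ?b \<le> (?A + defect k) * sqrt (real (Suc k) * noise_bound)"
      using A \<delta> by (intro mult_left_mono) auto
    moreover have "?b\<^sup>2 + noise_bound = (sqrt (real (Suc k) * noise_bound))\<^sup>2"
      using noise_bound_nonneg by (simp add: algebra_simps)
    ultimately show "(?A + defect k + ?b)\<^sup>2 + noise_bound
        \<le> (?A + defect k + sqrt (real (Suc k) * noise_bound))\<^sup>2"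
      unfolding power2_sum[of "?A + defect k"] by linarith
  qed
  finally show ?case by simp
qed

text \<open>The Cauchy-Schwarz inequality for the factors \<open>e / p\<close> and \<open>p\<close> of the error \<open>e\<close>, where \<open>p\<close> is the weight.
  Weights are at least \<open>1\<close> and grow along the chain, so their final second moment bounds the earlier ones.\<close>

lemma mean_error_le:
  assumes weight: "(\<integral>\<^sup>+w. ennreal ((snd (snd w))\<^sup>2) \<partial>law N) \<le> ennreal (\<Delta>\<^sup>2)" and "0 \<le> \<Delta>" and k: "k \<le> N"
  shows "(\<integral>\<^sup>+w. ennreal (qnorm Q (fst (snd w) - y (real k * \<alpha>))) \<partial>law k)
    \<le> ennreal ((C1 (\<lambda>_ _. D) \<alpha> N R y + C2 K\<^sub>1 K\<^sub>2 \<alpha> N R \<theta>\<^sub>0) * \<Delta>)"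
proof -
  let ?e = "\<lambda>w :: (real ^ 'd) \<times> (real ^ 'd) \<times> real. qnorm Q (fst (snd w) - y (real k * \<alpha>))"
  let ?p = "\<lambda>w :: (real ^ 'd) \<times> (real ^ 'd) \<times> real. snd (snd w)"
  let ?C = "C1 (\<lambda>_ _. D) \<alpha> N R y + C2 K\<^sub>1 K\<^sub>2 \<alpha> N R \<theta>\<^sub>0"
  have p: "AE w in law k. 1 \<le> ?p w"
    using step_pos weight_nonneg by (intro AE_chain_law_weight_ge) auto
  have le_C: "(\<Sum>i<k. defect i) + sqrt (real k * noise_bound) \<le> ?C"
    unfolding C1_eq_sum_defects sqrt_noise_bound[symmetric]
    using k noise_bound_nonneg
    by (intro add_mono sum_mono2 real_sqrt_le_mono mult_right_mono) (auto intro: defect_nonneg)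
  have nonneg: "0 \<le> (\<Sum>i<k. defect i) + sqrt (real k * noise_bound)"
    using k noise_bound_nonneg by (intro add_nonneg_nonneg sum_nonneg) (auto intro: defect_nonneg)
  have "(\<integral>\<^sup>+w. ennreal (?e w) \<partial>law k)\<^sup>2 = (\<integral>\<^sup>+w. ennreal (?e w / ?p w) * ennreal (?p w) \<partial>law k)\<^sup>2"
    using p by (intro arg_cong[where f = "\<lambda>x. x\<^sup>2"] nn_integral_cong_AE)
      (auto simp: ennreal_mult[symmetric] qnorm_nonneg[OF Q])
  also have "\<dots> \<le> (\<integral>\<^sup>+w. (ennreal (?e w / ?p w))\<^sup>2 \<partial>law k) * (\<integral>\<^sup>+w. (ennreal (?p w))\<^sup>2 \<partial>law k)"
    by (rule Cauchy_Schwarz_nn_integral) measurable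
  also have "(\<integral>\<^sup>+w. (ennreal (?e w / ?p w))\<^sup>2 \<partial>law k) = (\<integral>\<^sup>+w. ennreal ((?e w / ?p w)\<^sup>2) \<partial>law k)"
    using p by (intro nn_integral_cong_AE) (auto simp: ennreal_power qnorm_nonneg[OF Q])
  also have "\<dots> \<le> ennreal (?C\<^sup>2)"
    using weighted_error_second_moment[OF k] le_C nonneg
    by (auto intro: order_trans ennreal_leI power_mono)
  also have "(\<integral>\<^sup>+w. (ennreal (?p w))\<^sup>2 \<partial>law k) = (\<integral>\<^sup>+w. ennreal ((?p w)\<^sup>2) \<partial>law k)"
    using p by (intro nn_integral_cong_AE) (auto simp: ennreal_power)
  also have "\<dots> \<le> ennreal (\<Delta>\<^sup>2)"
    using nn_integral_weight_square_mono[OF less_imp_le[OF step_pos] weight_nonneg k] weight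
    by (rule order_trans)
  finally have "(\<integral>\<^sup>+w. ennreal (?e w) \<partial>law k)\<^sup>2 \<le> ennreal (?C\<^sup>2) * ennreal (\<Delta>\<^sup>2)"
    by (simp add: mult_left_mono mult_right_mono)
  also have "\<dots> = (ennreal (?C * \<Delta>))\<^sup>2"
    using le_C nonneg \<open>0 \<le> \<Delta>\<close> by (simp add: ennreal_mult[symmetric] ennreal_power power_mult_distrib)
  finally show ?thesis by (rule ennreal_power2_le_imp_le)
qed

end

section \<open>The conditional law of the iterates\<close>

context stochastic_algorithm
begin

abbreviation past :: "nat \<Rightarrow> 'w measure"
  where "past m \<equiv> natural_filtration M X m"

lemma space_past [simp]: "space (past m) = space M"
  unfolding natural_filtration_def by (rule space_measure_of) auto

lemma sets_past:
  "sets (past m) = sigma_sets (space M) {X i -` A \<inter> space M | i A. i \<le> m \<and> A \<in> sets borel}"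
  unfolding natural_filtration_def by (rule sets_measure_of) auto

lemma subalgebra_past: "subalgebra M (past m)"
proof -
  have "{X i -` A \<inter> space M | i A. i \<le> m \<and> A \<in> sets borel} \<subseteq> sets M"
    using measurable_sets[OF X_measurable] by auto
  then show ?thesis
    unfolding subalgebra_def sets_past using sets.sigma_sets_subset by simp
qed

lemma subalgebra_past_mono: "m \<le> m' \<Longrightarrow> subalgebra (past m') (past m)"
  unfolding subalgebra_def sets_past
  by (intro conjI sigma_sets_mono') (simp, blast intro: order_trans)

lemma sigma_finite_past: "sigma_finite_subalgebra M (past m)"
  by (intro finite_measure_subalgebra_is_sigma_finite finite_measure_subalgebra.intro
      finite_measure_subalgebra_axioms.intro finite_measure_axioms subalgebra_past)

lemma X_measurable_past [measurable]: "i \<le> m \<Longrightarrow> X i \<in> past m \<rightarrow>\<^sub>M borel"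
proof (rule measurableI)
  fix A :: "(real ^ 'd) set" assume "i \<le> m" "A \<in> sets borel"
  then show "X i -` A \<inter> space (past m) \<in> sets (past m)"
    unfolding sets_past space_past by (intro sigma_sets.Basic) auto
qed simp

lemma nn_cond_exp_past_of_measurable:
  assumes f: "f \<in> borel_measurable (past m)" and [measurable]: "g \<in> borel_measurable M"
    and AE: "AE \<omega> in M. g \<omega> = f \<omega>"
  shows "AE \<omega> in M. nn_cond_exp M (past m) g \<omega> = f \<omega>"
proof -
  have [measurable]: "f \<in> borel_measurable M"
    by (rule measurable_from_subalg[OF subalgebra_past f])
  have "AE \<omega> in M. f \<omega> = nn_cond_exp M (past m) g \<omega>"
  proof (rule sigma_finite_subalgebra.nn_cond_exp_charact[OF sigma_finite_past])
    show "(\<integral>\<^sup>+\<omega>\<in>A. g \<omega> \<partial>M) = (\<integral>\<^sup>+\<omega>\<in>A. f \<omega> \<partial>M)" for A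
      using AE by (intro nn_integral_cong_AE) auto
  qed (use f in auto)
  then show ?thesis by (auto simp: eq_commute)
qed

text \<open>Both sides are integrals of \<open>h\<close> against a measure on the product of the past with the space of
  increments. The hypothesis on the conditional distribution of \<open>G m\<close> says exactly that these two
  measures agree on rectangles.\<close>

lemma nn_integral_past_G:
  assumes h: "h \<in> borel_measurable (past m \<Otimes>\<^sub>M borel)"
  shows "(\<integral>\<^sup>+\<omega>. h (\<omega>, G m \<omega>) \<partial>M) = (\<integral>\<^sup>+\<omega>. (\<integral>\<^sup>+x. h (\<omega>, x) \<partial>K (X m \<omega>)) \<partial>M)"
proof -
  interpret F: sigma_finite_subalgebra M "past m" by (rule sigma_finite_past)
  have K_sets: "sets (K \<theta>) = sets borel" and K_prob: "prob_space (K \<theta>)" for \<theta>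
    using measurable_space[OF kernel, of \<theta>] by (auto simp: space_prob_algebra)
  define MF where "MF = restr_to_subalg M (past m)"
  have sets_MF: "sets MF = sets (past m)"
    unfolding MF_def by (rule sets_restr_to_subalg[OF subalgebra_past])
  have space_MF: "space MF = space M" by (simp add: MF_def space_restr_to_subalg)
  have K_past [measurable]: "(\<lambda>\<omega>. K (X m \<omega>)) \<in> past m \<rightarrow>\<^sub>M subprob_algebra borel"
    using measurable_comp[OF X_measurable_past[of m m] measurable_prob_algebraD[OF kernel]]
    by (simp add: comp_def)
  have past_id: "(\<lambda>\<omega>. \<omega>) \<in> M \<rightarrow>\<^sub>M past m"
    by (rule measurable_from_subalg[OF subalgebra_past measurable_ident_sets[OF refl]])
  have GM [measurable]: "(\<lambda>\<omega>. (\<omega>, G m \<omega>)) \<in> M \<rightarrow>\<^sub>M past m \<Otimes>\<^sub>M borel"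
    by (rule measurable_Pair[OF past_id G_measurable])
  define \<mu> where "\<mu> = distr M (past m \<Otimes>\<^sub>M borel) (\<lambda>\<omega>. (\<omega>, G m \<omega>))"
  define \<kappa> where "\<kappa> = (\<lambda>\<omega>. distr (K (X m \<omega>)) (past m \<Otimes>\<^sub>M borel) (\<lambda>x. (\<omega>, x)))"
  define \<nu> where "\<nu> = MF \<bind> \<kappa>"
  have \<kappa>_meas: "\<kappa> \<in> MF \<rightarrow>\<^sub>M subprob_algebra (past m \<Otimes>\<^sub>M borel)"
    unfolding \<kappa>_def measurable_cong_sets[OF sets_MF refl]
  proof (rule measurable_distr2[OF _ K_past])
    show "(\<lambda>(\<omega>, x). (\<omega>, x)) \<in> past m \<Otimes>\<^sub>M borel \<rightarrow>\<^sub>M past m \<Otimes>\<^sub>M borel" by simp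
  qed
  have \<nu>_int: "(\<integral>\<^sup>+z. f z \<partial>\<nu>) = (\<integral>\<^sup>+\<omega>. (\<integral>\<^sup>+x. f (\<omega>, x) \<partial>K (X m \<omega>)) \<partial>M)"
    if f [measurable]: "f \<in> borel_measurable (past m \<Otimes>\<^sub>M borel)" for f
  proof -
    have inner: "(\<lambda>\<omega>. \<integral>\<^sup>+x. f (\<omega>, x) \<partial>K (X m \<omega>)) \<in> borel_measurable (past m)"
      by (rule nn_integral_measurable_subprob_algebra2[where N = borel]) measurable
    have "(\<integral>\<^sup>+z. f z \<partial>\<nu>) = (\<integral>\<^sup>+\<omega>. (\<integral>\<^sup>+z. f z \<partial>\<kappa> \<omega>) \<partial>MF)"
      unfolding \<nu>_def by (rule nn_integral_bind[OF f \<kappa>_meas])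
    also have "\<dots> = (\<integral>\<^sup>+\<omega>. (\<integral>\<^sup>+x. f (\<omega>, x) \<partial>K (X m \<omega>)) \<partial>MF)"
      unfolding \<kappa>_def
      by (intro nn_integral_cong nn_integral_distr)
        (simp_all add: f measurable_cong_sets[OF K_sets refl] space_MF measurable_Pair1')
    also have "\<dots> = (\<integral>\<^sup>+\<omega>. (\<integral>\<^sup>+x. f (\<omega>, x) \<partial>K (X m \<omega>)) \<partial>M)"
      unfolding MF_def by (rule nn_integral_subalgebra2[OF subalgebra_past inner])
    finally show ?thesis .
  qed
  have "\<mu> = \<nu>"
  proof (rule measure_eqI_generator_eq)
    let ?E = "{a \<times> b | a b. a \<in> sets (past m) \<and> b \<in> sets (borel :: (real ^ 'd) measure)}"
    show "Int_stable ?E" by (rule Int_stable_pair_measure_generator)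
    show "?E \<subseteq> Pow (space M \<times> UNIV)"
      using sets.space_closed[of "past m"] by auto
    show "sets \<mu> = sigma_sets (space M \<times> UNIV) ?E"
      unfolding \<mu>_def by (simp add: sets_pair_measure)
    have "sets \<nu> = sets (past m \<Otimes>\<^sub>M borel)"
      unfolding \<nu>_def by (rule sets_bind[OF sets_kernel[OF \<kappa>_meas]]) (auto simp: space_MF not_empty)
    then show "sets \<nu> = sigma_sets (space M \<times> UNIV) ?E" by (simp add: sets_pair_measure)
    show "range (\<lambda>_. space M \<times> UNIV) \<subseteq> ?E"
      using sets.top[of "past m"] by (auto intro!: exI[of _ "space M"] exI[of _ "UNIV :: (real ^ 'd) set"])
    show "(\<Union>i::nat. space M \<times> UNIV) = space M \<times> (UNIV :: (real ^ 'd) set)" by simp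
    show "emeasure \<mu> (space M \<times> UNIV) \<noteq> \<infinity>"
      unfolding \<mu>_def using prob_space.emeasure_space_1[OF prob_space_distr[OF GM]]
      by (simp add: space_pair_measure)
    fix Z assume "Z \<in> ?E"
    then obtain C A where Z: "Z = C \<times> A" and C: "C \<in> sets (past m)" and A: "A \<in> sets borel" by auto
    have C_M [measurable]: "C \<in> sets M" using C subalgebra_past by (auto simp: subalgebra_def)
    have G_A [measurable]: "G m -` A \<inter> space M \<in> sets M"
      using measurable_sets[OF G_measurable A] .
    have meas_K: "(\<lambda>\<omega>. measure (K (X m \<omega>)) A) \<in> borel_measurable M"
      using measurable_from_subalg[OF subalgebra_past, of "\<lambda>\<omega>. measure (K (X m \<omega>)) A" m]
        measurable_comp[OF K_past measurable_measure_subprob_algebra[OF A]] by (simp add: comp_def)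
    have K_le: "measure (K \<theta>) A \<le> 1" for \<theta> by (rule prob_space.prob_le_1[OF K_prob])
    have Z_sets: "Z \<in> sets (past m \<Otimes>\<^sub>M borel)" using C A by (simp add: Z)
    have "emeasure \<mu> Z = emeasure M (C \<inter> (G m -` A \<inter> space M))"
      unfolding \<mu>_def using Z_sets GM sets.sets_into_space[OF C_M]
      by (auto simp: emeasure_distr Z intro!: arg_cong[where f = "emeasure M"])
    also have "\<dots> = ennreal (\<integral>\<omega>\<in>C. indicator (G m -` A \<inter> space M) \<omega> \<partial>M)"
      by (simp add: emeasure_eq_measure set_lebesgue_integral_def indicator_inter_arith[symmetric]
          Int_absorb2 sets.sets_into_space)
    also have "(\<integral>\<omega>\<in>C. indicator (G m -` A \<inter> space M) \<omega> \<partial>M)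
        = (\<integral>\<omega>\<in>C. real_cond_exp M (past m) (indicator (G m -` A \<inter> space M)) \<omega> \<partial>M)"
      by (rule F.real_cond_exp_intA) (auto simp: C emeasure_eq_measure)
    also have "\<dots> = (\<integral>\<omega>\<in>C. measure (K (X m \<omega>)) A \<partial>M)"
      using cond_distribution[OF A, of m] meas_K
      unfolding set_lebesgue_integral_def by (intro integral_cong_AE) auto
    also have "ennreal \<dots> = (\<integral>\<^sup>+\<omega>. indicator C \<omega> * ennreal (measure (K (X m \<omega>)) A) \<partial>M)"
    proof -
      have "integrable M (\<lambda>\<omega>. indicator C \<omega> *\<^sub>R measure (K (X m \<omega>)) A)"
        using meas_K K_le
        by (intro integrable_const_bound[where B = 1]) (auto simp: indicator_def)
      then have "ennreal (\<integral>\<omega>\<in>C. measure (K (X m \<omega>)) A \<partial>M)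
          = (\<integral>\<^sup>+\<omega>. ennreal (indicator C \<omega> *\<^sub>R measure (K (X m \<omega>)) A) \<partial>M)"
        unfolding set_lebesgue_integral_def by (intro nn_integral_eq_integral[symmetric]) auto
      also have "\<dots> = (\<integral>\<^sup>+\<omega>. indicator C \<omega> * ennreal (measure (K (X m \<omega>)) A) \<partial>M)"
        by (intro nn_integral_cong) (auto simp: indicator_def)
      finally show ?thesis .
    qed
    also have "\<dots> = (\<integral>\<^sup>+\<omega>. (\<integral>\<^sup>+x. indicator Z (\<omega>, x) \<partial>K (X m \<omega>)) \<partial>M)"
    proof (rule nn_integral_cong)
      fix \<omega>
      have "(\<integral>\<^sup>+x. indicator Z (\<omega>, x) \<partial>K (X m \<omega>)) = (\<integral>\<^sup>+x. indicator C \<omega> * indicator A x \<partial>K (X m \<omega>))"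
        by (intro nn_integral_cong) (auto simp: Z indicator_def)
      also have "\<dots> = indicator C \<omega> * emeasure (K (X m \<omega>)) A"
        using A by (intro nn_integral_cmult_indicator) (simp add: K_sets)
      finally show "indicator C \<omega> * ennreal (measure (K (X m \<omega>)) A)
          = (\<integral>\<^sup>+x. indicator Z (\<omega>, x) \<partial>K (X m \<omega>))"
        using finite_measure.emeasure_eq_measure[OF prob_space.finite_measure[OF K_prob]] by simp
    qed
    also have "\<dots> = (\<integral>\<^sup>+z. indicator Z z \<partial>\<nu>)"
      using Z_sets by (intro \<nu>_int[symmetric]) simp
    also have "\<dots> = emeasure \<nu> Z"
      using Z_sets \<open>sets \<nu> = sets (past m \<Otimes>\<^sub>M borel)\<close> by simp
    finally show "emeasure \<mu> Z = emeasure \<nu> Z" .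
  qed
  have "(\<integral>\<^sup>+\<omega>. h (\<omega>, G m \<omega>) \<partial>M) = (\<integral>\<^sup>+z. h z \<partial>\<mu>)"
    unfolding \<mu>_def by (rule nn_integral_distr[symmetric]) (use h in auto)
  then show ?thesis unfolding \<open>\<mu> = \<nu>\<close> using \<nu>_int[OF h] by simp
qed

lemma nn_cond_exp_next:
  assumes Z: "Z \<in> past m \<rightarrow>\<^sub>M borel" and g: "g \<in> borel_measurable (borel \<Otimes>\<^sub>M borel)"
  shows "AE \<omega> in M. nn_cond_exp M (past m) (\<lambda>\<omega>. g (Z \<omega>, G m \<omega>)) \<omega> = (\<integral>\<^sup>+x. g (Z \<omega>, x) \<partial>K (X m \<omega>))"
proof -
  note [measurable] = Z g G_measurable
  have [measurable]: "Z \<in> M \<rightarrow>\<^sub>M borel" by (rule measurable_from_subalg[OF subalgebra_past Z])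
  have [measurable]: "(\<lambda>\<omega>. K (X m \<omega>)) \<in> past m \<rightarrow>\<^sub>M subprob_algebra borel"
    using measurable_comp[OF X_measurable_past[of m m] measurable_prob_algebraD[OF kernel]]
    by (simp add: comp_def)
  have "AE \<omega> in M. (\<integral>\<^sup>+x. g (Z \<omega>, x) \<partial>K (X m \<omega>)) = nn_cond_exp M (past m) (\<lambda>\<omega>. g (Z \<omega>, G m \<omega>)) \<omega>"
  proof (rule sigma_finite_subalgebra.nn_cond_exp_charact[OF sigma_finite_past])
    fix A assume [measurable]: "A \<in> sets (past m)"
    have "(\<integral>\<^sup>+\<omega>\<in>A. g (Z \<omega>, G m \<omega>) \<partial>M)
        = (\<integral>\<^sup>+\<omega>. (\<lambda>(\<omega>, x). g (Z \<omega>, x) * indicator A \<omega>) (\<omega>, G m \<omega>) \<partial>M)" by simp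
    also have "\<dots> = (\<integral>\<^sup>+\<omega>. (\<integral>\<^sup>+x. (\<lambda>(\<omega>, x). g (Z \<omega>, x) * indicator A \<omega>) (\<omega>, x) \<partial>K (X m \<omega>)) \<partial>M)"
      by (rule nn_integral_past_G) measurable
    also have "\<dots> = (\<integral>\<^sup>+\<omega>\<in>A. (\<integral>\<^sup>+x. g (Z \<omega>, x) \<partial>K (X m \<omega>)) \<partial>M)"
      by (intro nn_integral_cong) (auto simp: indicator_def)
    finally show "(\<integral>\<^sup>+\<omega>\<in>A. g (Z \<omega>, G m \<omega>) \<partial>M) = (\<integral>\<^sup>+\<omega>\<in>A. (\<integral>\<^sup>+x. g (Z \<omega>, x) \<partial>K (X m \<omega>)) \<partial>M)" .
  next
    show "(\<lambda>\<omega>. \<integral>\<^sup>+x. g (Z \<omega>, x) \<partial>K (X m \<omega>)) \<in> borel_measurable (past m)"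
      by (rule nn_integral_measurable_subprob_algebra2[where N = borel]) measurable
  qed measurable
  then show ?thesis by (auto simp: eq_commute)
qed

definition path_state ::
    "((real ^ 'd) \<times> (real ^ 'd) \<Rightarrow> real) \<Rightarrow> nat \<Rightarrow> nat \<Rightarrow> 'w \<Rightarrow> (real ^ 'd) \<times> (real ^ 'd) \<times> real"
  where "path_state l n k \<omega> =
    (X n \<omega>, X (n + k) \<omega>, \<Prod>j<k. (1 + \<alpha> * l (X n \<omega>, X (n + j) \<omega>)))"

lemma path_state_0: "path_state l n 0 \<omega> = (X n \<omega>, X n \<omega>, 1)"
  by (simp add: path_state_def)

lemma path_state_Suc:
  "\<omega> \<in> space M \<Longrightarrow> path_state l n (Suc k) \<omega> = chain_step \<alpha> l (path_state l n k \<omega>) (G (n + k) \<omega>)"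
  by (simp add: path_state_def chain_step_def update)

lemma path_state_measurable:
  assumes l [measurable]: "l \<in> borel_measurable borel"
  shows "path_state l n k \<in> past (n + k) \<rightarrow>\<^sub>M borel"
proof -
  have [measurable]: "l \<in> borel_measurable (borel \<Otimes>\<^sub>M borel)" using l by (simp add: borel_prod)
  show ?thesis
    unfolding path_state_def by (simp add: borel_prod[symmetric])
qed

text \<open>The Markov property. Conditioning on the past of the last step replaces the integrand by its
  integral against the one-step kernel, and by the tower property this removes the steps one by one.\<close>

lemma nn_cond_exp_path_state:
  assumes l: "l \<in> borel_measurable borel" and f: "f \<in> borel_measurable borel"
  shows "AE \<omega> in M. nn_cond_exp M (past n) (\<lambda>\<omega>. f (path_state l n k \<omega>)) \<omega>
    = (\<integral>\<^sup>+w. f w \<partial>chain_law K \<alpha> l k (X n \<omega>, X n \<omega>, 1))"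
  using f
proof (induction k arbitrary: f)
  case 0
  interpret weighted_chain K \<alpha> l using kernel l by unfold_locales
  have "path_state l n 0 \<in> past n \<rightarrow>\<^sub>M borel" using path_state_measurable[OF l, of n 0] by simp
  then have f': "(\<lambda>\<omega>. f (path_state l n 0 \<omega>)) \<in> borel_measurable (past n)"
    using 0 by measurable
  have "AE \<omega> in M. nn_cond_exp M (past n) (\<lambda>\<omega>. f (path_state l n 0 \<omega>)) \<omega> = f (path_state l n 0 \<omega>)"
    by (rule nn_cond_exp_past_of_measurable[OF f' measurable_from_subalg[OF subalgebra_past f']]) simp
  then show ?case
    by eventually_elim (simp only: nn_integral_chain_law_0[OF 0] path_state_0)
next
  case (Suc k)
  interpret weighted_chain K \<alpha> l using kernel l by unfold_locales
  note [measurable] = Suc.prems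
  interpret F: sigma_finite_subalgebra M "past n" by (rule sigma_finite_past)
  define f' where "f' w = (\<integral>\<^sup>+x. f (chain_step \<alpha> l w x) \<partial>K (fst (snd w)))" for w
  have f': "f' \<in> borel_measurable borel"
  proof -
    have "(\<lambda>w. K (fst (snd w))) \<in> (borel :: ((real ^ 'd) \<times> (real ^ 'd) \<times> real) measure) \<rightarrow>\<^sub>M subprob_algebra borel"
      by (rule measurable_prob_algebraD) (simp add: borel_prod[symmetric])
    then show ?thesis
      unfolding f'_def by (rule nn_integral_measurable_subprob_algebra2[rotated]) measurable
  qed
  have state_M: "path_state l n j \<in> M \<rightarrow>\<^sub>M borel" for j
    by (rule measurable_from_subalg[OF subalgebra_past path_state_measurable[OF l]])
  have fM: "(\<lambda>\<omega>. f (path_state l n (Suc k) \<omega>)) \<in> borel_measurable M"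
    using state_M[of "Suc k"] by measurable
  have f'M: "(\<lambda>\<omega>. f' (path_state l n k \<omega>)) \<in> borel_measurable M"
    using state_M[of k] f' by measurable
  have gM: "(\<lambda>\<omega>. f (chain_step \<alpha> l (path_state l n k \<omega>) (G (n + k) \<omega>))) \<in> borel_measurable M"
    using fM by (subst measurable_cong[where g = "\<lambda>\<omega>. f (path_state l n (Suc k) \<omega>)"]) (auto simp: path_state_Suc)
  have "AE \<omega> in M. nn_cond_exp M (past (n + k)) (\<lambda>\<omega>. f (path_state l n (Suc k) \<omega>)) \<omega>
      = nn_cond_exp M (past (n + k)) (\<lambda>\<omega>. f (chain_step \<alpha> l (path_state l n k \<omega>) (G (n + k) \<omega>))) \<omega>"
    by (rule sigma_finite_subalgebra.nn_cond_exp_cong[OF sigma_finite_past _ fM gM])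
      (auto simp: path_state_Suc intro!: AE_I2)
  moreover have "AE \<omega> in M. nn_cond_exp M (past (n + k))
      (\<lambda>\<omega>. f (chain_step \<alpha> l (path_state l n k \<omega>) (G (n + k) \<omega>))) \<omega> = f' (path_state l n k \<omega>)"
    using nn_cond_exp_next[OF path_state_measurable[OF l, of n k],
        of "\<lambda>(w, x). f (chain_step \<alpha> l w x)"]
    by (simp add: f'_def path_state_def)
  ultimately have "AE \<omega> in M. nn_cond_exp M (past (n + k)) (\<lambda>\<omega>. f (path_state l n (Suc k) \<omega>)) \<omega>
      = f' (path_state l n k \<omega>)"
    by eventually_elim simp
  then have "AE \<omega> in M. nn_cond_exp M (past n) (nn_cond_exp M (past (n + k)) (\<lambda>\<omega>. f (path_state l n (Suc k) \<omega>))) \<omega>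
      = nn_cond_exp M (past n) (\<lambda>\<omega>. f' (path_state l n k \<omega>)) \<omega>"
    by (rule F.nn_cond_exp_cong) (use f'M in auto)
  moreover have "AE \<omega> in M. nn_cond_exp M (past n) (\<lambda>\<omega>. f (path_state l n (Suc k) \<omega>)) \<omega>
      = nn_cond_exp M (past n) (nn_cond_exp M (past (n + k)) (\<lambda>\<omega>. f (path_state l n (Suc k) \<omega>))) \<omega>"
    by (rule F.nn_cond_exp_nested_subalg[OF subalgebra_past subalgebra_past_mono fM]) simp
  moreover note Suc.IH[OF f']
  ultimately show ?case
    by eventually_elim (simp add: nn_integral_chain_law_Suc[OF Suc.prems] f'_def del: chain_law.simps)
qed

text \<open>The integrands that occur below agree with functions of the state only when the present lies in a
  given set, which suffices since that set belongs to the past.\<close>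

lemma nn_cond_exp_eq_chain_law:
  assumes l: "l \<in> borel_measurable borel" and f: "f \<in> borel_measurable borel"
    and g [measurable]: "g \<in> borel_measurable M" and V [measurable]: "V \<in> sets borel"
    and eq: "AE \<omega> in M. X n \<omega> \<in> V \<longrightarrow> g \<omega> = f (path_state l n k \<omega>)"
  shows "AE \<omega> in M. X n \<omega> \<in> V \<longrightarrow>
    nn_cond_exp M (past n) g \<omega> = (\<integral>\<^sup>+w. f w \<partial>chain_law K \<alpha> l k (X n \<omega>, X n \<omega>, 1))"
proof -
  interpret F: sigma_finite_subalgebra M "past n" by (rule sigma_finite_past)
  have I: "(\<lambda>\<omega>. indicator V (X n \<omega>) :: ennreal) \<in> borel_measurable (past n)"
    using X_measurable_past[of n n] by measurable
  have [measurable]: "(\<lambda>\<omega>. indicator V (X n \<omega>) :: ennreal) \<in> borel_measurable M"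
    by (rule measurable_from_subalg[OF subalgebra_past I])
  have "path_state l n k \<in> M \<rightarrow>\<^sub>M borel"
    by (rule measurable_from_subalg[OF subalgebra_past path_state_measurable[OF l]])
  then have [measurable]: "(\<lambda>\<omega>. f (path_state l n k \<omega>)) \<in> borel_measurable M"
    using f by measurable
  have "AE \<omega> in M. nn_cond_exp M (past n) (\<lambda>\<omega>. indicator V (X n \<omega>) * g \<omega>) \<omega>
      = nn_cond_exp M (past n) (\<lambda>\<omega>. indicator V (X n \<omega>) * f (path_state l n k \<omega>)) \<omega>"
  proof (rule F.nn_cond_exp_cong)
    show "AE \<omega> in M. indicator V (X n \<omega>) * g \<omega> = indicator V (X n \<omega>) * f (path_state l n k \<omega>)"
      using eq by eventually_elim (simp add: indicator_def)
  qed measurable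
  moreover have "AE \<omega> in M. indicator V (X n \<omega>) * nn_cond_exp M (past n) g \<omega>
      = nn_cond_exp M (past n) (\<lambda>\<omega>. indicator V (X n \<omega>) * g \<omega>) \<omega>"
    by (rule F.nn_cond_exp_prod[OF I g])
  moreover have "AE \<omega> in M. indicator V (X n \<omega>) * nn_cond_exp M (past n) (\<lambda>\<omega>. f (path_state l n k \<omega>)) \<omega>
      = nn_cond_exp M (past n) (\<lambda>\<omega>. indicator V (X n \<omega>) * f (path_state l n k \<omega>)) \<omega>"
    by (rule F.nn_cond_exp_prod[OF I]) measurable
  moreover note nn_cond_exp_path_state[OF l f, of n k]
  ultimately show ?thesis
  proof eventually_elim
    case (elim \<omega>)
    show ?case
    proof
      assume "X n \<omega> \<in> V"
      then have "indicator V (X n \<omega>) = (1 :: ennreal)" by simp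
      with elim show "nn_cond_exp M (past n) g \<omega>
          = (\<integral>\<^sup>+w. f w \<partial>chain_law K \<alpha> l k (X n \<omega>, X n \<omega>, 1))" by (metis mult_1)
    qed
  qed
qed

end

section \<open>The error bound\<close>

lemma borel_measurable_if_restrict:
  fixes f :: "'a::topological_space \<Rightarrow> real" and h :: "'b::topological_space \<Rightarrow> 'a"
  assumes f: "f \<in> borel_measurable (restrict_space borel A)" and W: "W \<in> sets borel"
    and h: "h \<in> borel \<rightarrow>\<^sub>M borel" and "\<And>u. u \<in> W \<Longrightarrow> h u \<in> A"
  shows "(\<lambda>u. if u \<in> W then f (h u) else 0) \<in> borel_measurable borel"
proof -
  have "h \<in> restrict_space borel W \<rightarrow>\<^sub>M restrict_space borel A"
    using assms by (intro measurable_restrict_space3) auto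
  from measurable_comp[OF this f] have "(\<lambda>u. f (h u)) \<in> borel_measurable (restrict_space borel W)"
    by (simp add: comp_def)
  then show ?thesis using W by (subst (asm) measurable_restrict_space_iff) auto
qed

theorem theorem9:
  fixes M :: "'w measure"
    and \<Theta> U :: "(real ^ 'd) set"
    and \<alpha> :: real
    and X G :: "nat \<Rightarrow> 'w \<Rightarrow> real ^ 'd"
    and K :: "real ^ 'd \<Rightarrow> (real ^ 'd) measure"
    and \<phi> :: "real \<Rightarrow> real ^ 'd \<Rightarrow> real ^ 'd"
    and \<Psi> :: "real ^ 'd \<Rightarrow> real"
    and S T :: "nat \<Rightarrow> real ^ 'd \<Rightarrow> (real ^ 'd) set"
    and Q :: "nat \<Rightarrow> real ^ 'd \<Rightarrow> real ^ 'd ^ 'd"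
    and L R :: "nat \<Rightarrow> real ^ 'd \<Rightarrow> real ^ 'd \<Rightarrow> real"
    and \<Delta>\<^sub>L \<Delta>\<^sub>L' :: "real \<Rightarrow> real \<Rightarrow> real"
    and K\<^sub>1 K\<^sub>2 :: "nat \<Rightarrow> real"
    and n :: nat
  defines "F \<equiv> mean_field K"
  assumes alg: "stochastic_algorithm M \<Theta> \<alpha> X G K"
    and U: "U \<subseteq> \<Theta>"
    and Psi_nonneg: "\<And>\<theta>. \<theta> \<in> \<Theta> \<Longrightarrow> 0 \<le> \<Psi> \<theta>"
    and flow: "\<And>N \<theta>\<^sub>0. 1 \<le> N \<Longrightarrow> \<theta>\<^sub>0 \<in> U \<Longrightarrow> flow_solution F \<Theta> \<theta>\<^sub>0 (real N * \<alpha>) (\<lambda>t. \<phi> t \<theta>\<^sub>0)"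
    and S_sub: "\<And>N \<theta>\<^sub>0. 1 \<le> N \<Longrightarrow> \<theta>\<^sub>0 \<in> U \<Longrightarrow> S N \<theta>\<^sub>0 \<subseteq> \<Theta>"
    and S_stay: "\<And>N. 1 \<le> N \<Longrightarrow>
      AE \<omega> in M. X n \<omega> \<in> U \<longrightarrow> (\<forall>k\<le>N. X (n + k) \<omega> \<in> S N (X n \<omega>))"
    and T_sub: "\<And>N \<theta>\<^sub>0. 1 \<le> N \<Longrightarrow> \<theta>\<^sub>0 \<in> U \<Longrightarrow> T N \<theta>\<^sub>0 \<subseteq> \<Theta>"
    and T_stay: "\<And>N \<theta>\<^sub>0 t. 1 \<le> N \<Longrightarrow> \<theta>\<^sub>0 \<in> U \<Longrightarrow> t \<in> {0..real N * \<alpha>} \<Longrightarrow> \<phi> t \<theta>\<^sub>0 \<in> T N \<theta>\<^sub>0"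
    \<comment> \<open>measurability conventions making the almost-sure statements, the conditional
      expectations and the integral in \<open>C1\<close> meaningful\<close>
    and S_meas: "\<And>N. 1 \<le> N \<Longrightarrow> {(\<theta>\<^sub>0, \<theta>). \<theta>\<^sub>0 \<in> U \<and> \<theta> \<in> S N \<theta>\<^sub>0} \<in> sets borel"
    and Psi_meas: "\<Psi> \<in> borel_measurable (restrict_space borel \<Theta>)"
    and Psi_flow_meas: "\<And>t. 0 \<le> t \<Longrightarrow> (\<lambda>\<theta>. \<Psi> (\<phi> t \<theta>)) \<in> borel_measurable (restrict_space borel \<Theta>)"
    and L_meas: "\<And>N. 1 \<le> N \<Longrightarrow> (\<lambda>(\<theta>, \<theta>\<^sub>0). L N \<theta> \<theta>\<^sub>0) \<in> borel_measurable (restrict_space borel (\<Theta> \<times> \<Theta>))"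
    and R_meas: "\<And>N \<theta>\<^sub>0. 1 \<le> N \<Longrightarrow> \<theta>\<^sub>0 \<in> U \<Longrightarrow>
      (\<lambda>t. R N \<theta>\<^sub>0 (\<phi> t \<theta>\<^sub>0)) \<in> borel_measurable (lebesgue_on {0..real N * \<alpha>})"
    \<comment> \<open>(P1)\<close>
    and P1_Q: "\<And>N \<theta>\<^sub>0. 1 \<le> N \<Longrightarrow> \<theta>\<^sub>0 \<in> U \<Longrightarrow> pos_def_sym (Q N \<theta>\<^sub>0)"
    and P1: "\<And>N \<theta>\<^sub>0. 1 \<le> N \<Longrightarrow> \<theta>\<^sub>0 \<in> U \<Longrightarrow>
      (\<forall>\<theta> \<in> convex hull (S N \<theta>\<^sub>0 \<union> T N \<theta>\<^sub>0).
        (SUP h \<in> {h. norm h = 1}. \<bar>upper_dini \<Psi> \<theta> h\<bar> * ereal (qnorm (matrix_inv (Q N \<theta>\<^sub>0)) h)) \<le> 1) \<or>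
      (\<forall>\<theta> \<in> convex hull (S N \<theta>\<^sub>0 \<union> T N \<theta>\<^sub>0).
        \<exists>g. GDERIV \<Psi> \<theta> :> g \<and> qnorm (matrix_inv (Q N \<theta>\<^sub>0)) g \<le> 1)"
    \<comment> \<open>(P2)\<close>
    and P2_L_pos: "\<And>N \<theta>\<^sub>0 \<theta>. 1 \<le> N \<Longrightarrow> \<theta>\<^sub>0 \<in> U \<Longrightarrow> \<theta> \<in> S N \<theta>\<^sub>0 \<Longrightarrow> 0 < L N \<theta> \<theta>\<^sub>0"
    and P2_Lipschitz: "\<And>N \<theta>\<^sub>0 \<theta> \<theta>'. 1 \<le> N \<Longrightarrow> \<theta>\<^sub>0 \<in> U \<Longrightarrow> \<theta> \<in> S N \<theta>\<^sub>0 \<Longrightarrow> \<theta>' \<in> T N \<theta>\<^sub>0 \<Longrightarrow>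
      qnorm (Q N \<theta>\<^sub>0) (F \<theta> - F \<theta>') \<le> L N \<theta> \<theta>\<^sub>0 * qnorm (Q N \<theta>\<^sub>0) (\<theta> - \<theta>')"
    and P2_mono: "nondecreasing2 \<Delta>\<^sub>L"
    and P2_expectation: "\<And>N. 1 \<le> N \<Longrightarrow>
      AE \<omega> in M. X n \<omega> \<in> U \<longrightarrow>
        esqrt (nn_cond_exp M (natural_filtration M X n)
          (\<lambda>\<omega>'. ennreal (\<Prod>k<N. (1 + \<alpha> * L N (X (n + k) \<omega>') (X n \<omega>'))\<^sup>2)) \<omega>)
        \<le> ereal (\<Delta>\<^sub>L \<alpha> (real N * \<alpha>))"
    \<comment> \<open>(P3)\<close>
    and P3_mono: "nondecreasing2 \<Delta>\<^sub>L'"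
    and P3_nonneg: "\<And>N. 1 \<le> N \<Longrightarrow> 0 \<le> \<Delta>\<^sub>L' \<alpha> (real N * \<alpha>)"
    and P3_Lipschitz: "\<And>N \<theta>\<^sub>0 \<theta> \<theta>'. 1 \<le> N \<Longrightarrow> \<theta>\<^sub>0 \<in> U \<Longrightarrow> \<theta> \<in> T N \<theta>\<^sub>0 \<Longrightarrow> \<theta>' \<in> T N \<theta>\<^sub>0 \<Longrightarrow>
      qnorm (Q N \<theta>\<^sub>0) (F \<theta> - F \<theta>') \<le> \<Delta>\<^sub>L' \<alpha> (real N * \<alpha>) * qnorm (Q N \<theta>\<^sub>0) (\<theta> - \<theta>')"
    \<comment> \<open>(P4)\<close>
    and P4_nonneg: "\<And>N. 1 \<le> N \<Longrightarrow> 0 \<le> K\<^sub>1 N \<and> 0 \<le> K\<^sub>2 N"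
    and P4_moment: "\<And>N \<theta>\<^sub>0 \<theta>. 1 \<le> N \<Longrightarrow> \<theta>\<^sub>0 \<in> U \<Longrightarrow> \<theta> \<in> S N \<theta>\<^sub>0 \<union> T N \<theta>\<^sub>0 \<Longrightarrow>
      esqrt (\<integral>\<^sup>+x. ennreal ((qnorm (Q N \<theta>\<^sub>0) x)\<^sup>2) \<partial>K \<theta>) \<le> ereal (R N \<theta>\<^sub>0 \<theta>)"
    and P4_growth: "\<And>N \<theta>\<^sub>0 \<theta>\<^sub>a \<theta>\<^sub>b. 1 \<le> N \<Longrightarrow> \<theta>\<^sub>0 \<in> U \<Longrightarrow>
      \<theta>\<^sub>a \<in> S N \<theta>\<^sub>0 \<union> T N \<theta>\<^sub>0 \<Longrightarrow> \<theta>\<^sub>b \<in> S N \<theta>\<^sub>0 \<union> T N \<theta>\<^sub>0 \<Longrightarrow>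
      (R N \<theta>\<^sub>0 \<theta>\<^sub>a)\<^sup>2 \<le> (K\<^sub>1 N)\<^sup>2 * (qnorm (Q N \<theta>\<^sub>0) (\<theta>\<^sub>a - \<theta>\<^sub>b))\<^sup>2 + (K\<^sub>2 N)\<^sup>2 * (R N \<theta>\<^sub>0 \<theta>\<^sub>b)\<^sup>2"
  shows "\<forall>N \<ge> 1.
      (\<forall>\<theta>\<^sub>0 \<in> U.
        flow_solution F (T N \<theta>\<^sub>0) \<theta>\<^sub>0 (real N * \<alpha>) (\<lambda>t. \<phi> t \<theta>\<^sub>0) \<and>
        (\<forall>y. flow_solution F (T N \<theta>\<^sub>0) \<theta>\<^sub>0 (real N * \<alpha>) y \<longrightarrow>
          (\<forall>t \<in> {0..real N * \<alpha>}. y t = \<phi> t \<theta>\<^sub>0))) \<and>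
      (AE \<omega> in M. X n \<omega> \<in> U \<longrightarrow>
        (SUP k \<in> {0..N}. nn_cond_exp M (natural_filtration M X n)
          (\<lambda>\<omega>'. ennreal \<bar>\<Psi> (X (n + k) \<omega>') - \<Psi> (\<phi> (real k * \<alpha>) (X n \<omega>'))\<bar>) \<omega>)
        \<le> ennreal ((C1 \<Delta>\<^sub>L' \<alpha> N (R N (X n \<omega>)) (\<lambda>t. \<phi> t (X n \<omega>))
                    + C2 (K\<^sub>1 N) (K\<^sub>2 N) \<alpha> N (R N (X n \<omega>)) (X n \<omega>))
                   * \<Delta>\<^sub>L \<alpha> (real N * \<alpha>)))"
proof (intro allI impI conjI ballI)
  fix N :: nat assume N: "1 \<le> N"
  show "flow_solution F (T N \<theta>\<^sub>0) \<theta>\<^sub>0 (real N * \<alpha>) (\<lambda>t. \<phi> t \<theta>\<^sub>0)" if "\<theta>\<^sub>0 \<in> U" for \<theta>\<^sub>0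
    using flow[OF N that] T_stay[OF N that] unfolding flow_solution_def by blast
  then show "y t = \<phi> t \<theta>\<^sub>0"
    if "\<theta>\<^sub>0 \<in> U" "flow_solution F (T N \<theta>\<^sub>0) \<theta>\<^sub>0 (real N * \<alpha>) y" "t \<in> {0..real N * \<alpha>}" for \<theta>\<^sub>0 y t
    using that N by (intro flow_solution_unique[OF P1_Q P3_nonneg P3_Lipschitz]) auto
next
  fix N :: nat assume N: "1 \<le> N"
  interpret stochastic_algorithm M \<Theta> \<alpha> X G K by (rule alg)
  define W where "W = {(\<theta>\<^sub>0, \<theta>). \<theta>\<^sub>0 \<in> U \<and> \<theta> \<in> S N \<theta>\<^sub>0}"
  have W [measurable]: "W \<in> sets borel" unfolding W_def by (rule S_meas[OF N])
  have W_sub: "W \<subseteq> \<Theta> \<times> \<Theta>" using U S_sub[OF N] by (auto simp: W_def)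
  \<comment> \<open>A Borel subset of \<open>U\<close> that contains \<open>X n\<close> almost surely whenever \<open>U\<close> does, as \<open>k = 0\<close> in \<open>S_stay\<close> shows.\<close>
  define V where "V = {\<theta>. (\<theta>, \<theta>) \<in> W}"
  have V [measurable]: "V \<in> sets borel"
  proof -
    have "(\<lambda>\<theta>. (\<theta>, \<theta>)) \<in> borel \<rightarrow>\<^sub>M (borel :: ((real ^ 'd) \<times> (real ^ 'd)) measure)"
      by (simp add: borel_prod[symmetric])
    from measurable_sets[OF this W] show ?thesis by (simp add: V_def vimage_def)
  qed
  have V_sub: "V \<subseteq> U" by (auto simp: V_def W_def)
  have in_W: "AE \<omega> in M. X n \<omega> \<in> U \<longrightarrow> (\<forall>k\<le>N. (X n \<omega>, X (n + k) \<omega>) \<in> W)"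
    using S_stay[OF N] by (auto simp: W_def)
  then have in_V: "AE \<omega> in M. X n \<omega> \<in> U \<longrightarrow> X n \<omega> \<in> V"
    by eventually_elim (auto simp: V_def dest: spec[of _ 0])
  define l where "l u = (if u \<in> W then (\<lambda>(\<theta>, \<theta>\<^sub>0). L N \<theta> \<theta>\<^sub>0) (snd u, fst u) else 0)" for u
  have l: "l \<in> borel_measurable borel"
    unfolding l_def using W_sub
    by (intro borel_measurable_if_restrict[OF L_meas[OF N] W])
      (auto simp: borel_prod[symmetric])
  have l_nonneg: "0 \<le> l u" for u
    using P2_L_pos[OF N] by (auto simp: l_def W_def intro: less_imp_le)
  have l_eq: "l (\<theta>\<^sub>0, \<theta>) = L N \<theta> \<theta>\<^sub>0" if "\<theta>\<^sub>0 \<in> U" "\<theta> \<in> S N \<theta>\<^sub>0" for \<theta>\<^sub>0 \<theta>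
    using that by (simp add: l_def W_def)
  interpret weighted_chain K \<alpha> l using kernel l by unfold_locales
  have projections [measurable]:
    "fst \<in> (borel :: ((real ^ 'd) \<times> (real ^ 'd) \<times> real) measure) \<rightarrow>\<^sub>M borel"
    "(\<lambda>w. fst (snd w)) \<in> (borel :: ((real ^ 'd) \<times> (real ^ 'd) \<times> real) measure) \<rightarrow>\<^sub>M borel"
    "(\<lambda>w. snd (snd w)) \<in> (borel :: ((real ^ 'd) \<times> (real ^ 'd) \<times> real) measure) \<rightarrow>\<^sub>M borel"
    "(\<lambda>w. (fst w, fst (snd w))) \<in> (borel :: ((real ^ 'd) \<times> (real ^ 'd) \<times> real) measure) \<rightarrow>\<^sub>M borel"
    by (simp_all add: borel_prod[symmetric])
  have X_\<Theta>: "X m \<in> M \<rightarrow>\<^sub>M restrict_space borel \<Theta>" for m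
    using X_measurable[of m] never_leaves by (intro measurable_restrict_space2) auto
  let ?law = "\<lambda>k \<omega>. chain_law K \<alpha> l k (X n \<omega>, X n \<omega>, 1)"
  let ?\<Delta> = "\<Delta>\<^sub>L \<alpha> (real N * \<alpha>)"
  \<comment> \<open>The two almost sure hypotheses and the left-hand side, expressed through the chain started at \<open>X n \<omega>\<close>.\<close>
  have chain_stay: "AE \<omega> in M. X n \<omega> \<in> V \<longrightarrow> (AE w in ?law k \<omega>. fst (snd w) \<in> S N (X n \<omega>))"
    if k: "k \<le> N" for k
  proof -
    define B where "B = {w :: (real ^ 'd) \<times> (real ^ 'd) \<times> real. (fst w, fst (snd w)) \<notin> W}"
    have B [measurable]: "B \<in> sets borel"
      using measurable_sets[OF projections(4), of "- W"] by (simp add: B_def vimage_def)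
    have f: "(indicator B :: _ \<Rightarrow> ennreal) \<in> borel_measurable borel" by measurable
    have "AE \<omega> in M. X n \<omega> \<in> V \<longrightarrow>
        nn_cond_exp M (past n) (\<lambda>_. 0) \<omega> = (\<integral>\<^sup>+w. indicator B w \<partial>?law k \<omega>)"
    proof (rule nn_cond_exp_eq_chain_law[OF l f _ V])
      show "AE \<omega> in M. X n \<omega> \<in> V \<longrightarrow> 0 = indicator B (path_state l n k \<omega>)"
        using in_W by eventually_elim (use V_sub k in \<open>auto simp: B_def path_state_def\<close>)
    qed simp
    moreover have "AE \<omega> in M. nn_cond_exp M (past n) (\<lambda>_. 0) \<omega> = 0"
      by (rule nn_cond_exp_past_of_measurable) auto
    ultimately show ?thesis
    proof eventually_elim
      case (elim \<omega>)
      show ?case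
      proof
        assume "X n \<omega> \<in> V"
        with elim have "(\<integral>\<^sup>+w. indicator B w \<partial>?law k \<omega>) = 0" by simp
        then have "AE w in ?law k \<omega>. w \<notin> B"
          by (subst (asm) nn_integral_0_iff_AE) (auto simp: indicator_def split: if_splits)
        moreover have "AE w in ?law k \<omega>. fst w = X n \<omega>"
          using AE_chain_law_fst[of "(X n \<omega>, X n \<omega>, 1)" k] by simp
        ultimately show "AE w in ?law k \<omega>. fst (snd w) \<in> S N (X n \<omega>)"
          by eventually_elim (auto simp: B_def W_def)
      qed
    qed
  qed
  have chain_weight: "AE \<omega> in M. X n \<omega> \<in> V \<longrightarrow>
      0 \<le> ?\<Delta> \<and> (\<integral>\<^sup>+w. ennreal ((snd (snd w))\<^sup>2) \<partial>?law N \<omega>) \<le> ennreal (?\<Delta>\<^sup>2)"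
  proof -
    let ?g = "\<lambda>\<omega>. ennreal (\<Prod>k<N. (1 + \<alpha> * L N (X (n + k) \<omega>) (X n \<omega>))\<^sup>2)"
    have L_X: "(\<lambda>\<omega>. L N (X (n + k) \<omega>) (X n \<omega>)) \<in> borel_measurable M" for k
    proof -
      have "(\<lambda>\<omega>. (X (n + k) \<omega>, X n \<omega>)) \<in> M \<rightarrow>\<^sub>M restrict_space borel (\<Theta> \<times> \<Theta>)"
        using X_measurable[of "n + k"] X_measurable[of n] never_leaves
        by (intro measurable_restrict_space2) (auto simp: borel_prod[symmetric])
      from measurable_comp[OF this L_meas[OF N]] show ?thesis by (simp add: comp_def)
    qed
    have "AE \<omega> in M. X n \<omega> \<in> V \<longrightarrow>
        nn_cond_exp M (past n) ?g \<omega> = (\<integral>\<^sup>+w. ennreal ((snd (snd w))\<^sup>2) \<partial>?law N \<omega>)"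
    proof (rule nn_cond_exp_eq_chain_law[OF l _ _ V])
      show "?g \<in> borel_measurable M" using L_X by measurable
      show "AE \<omega> in M. X n \<omega> \<in> V \<longrightarrow> ?g \<omega> = ennreal ((snd (snd (path_state l n N \<omega>)))\<^sup>2)"
        using in_W
      proof eventually_elim
        case (elim \<omega>)
        have "(1 + \<alpha> * L N (X (n + k) \<omega>) (X n \<omega>))\<^sup>2 = (1 + \<alpha> * l (X n \<omega>, X (n + k) \<omega>))\<^sup>2"
          if "X n \<omega> \<in> V" "k < N" for k
          using elim that V_sub by (auto simp: l_def)
        then show ?case by (auto simp: path_state_def prod_power_distrib[symmetric])
      qed
    qed measurable
    with P2_expectation[OF N] show ?thesis
      by eventually_elim (use V_sub in \<open>auto simp: esqrt_le_iff\<close>)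
  qed
  have chain_error: "AE \<omega> in M. X n \<omega> \<in> V \<longrightarrow>
      nn_cond_exp M (past n) (\<lambda>\<omega>. ennreal \<bar>\<Psi> (X (n + k) \<omega>) - \<Psi> (\<phi> (real k * \<alpha>) (X n \<omega>))\<bar>) \<omega>
      = (\<integral>\<^sup>+w. (if (fst w, fst (snd w)) \<in> W
          then ennreal \<bar>\<Psi> (fst (snd w)) - \<Psi> (\<phi> (real k * \<alpha>) (fst w))\<bar> else 0) \<partial>?law k \<omega>)"
    if k: "k \<le> N" for k
  proof (rule nn_cond_exp_eq_chain_law[OF l _ _ V])
    have flow_meas: "(\<lambda>\<theta>. \<Psi> (\<phi> (real k * \<alpha>) \<theta>)) \<in> borel_measurable (restrict_space borel \<Theta>)"
      using step_size_pos by (intro Psi_flow_meas) simp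
    have "(\<lambda>u. if u \<in> W then \<Psi> (snd u) else 0) \<in> borel_measurable borel"
      using W_sub by (intro borel_measurable_if_restrict[OF Psi_meas W]) (auto simp: borel_prod[symmetric])
    moreover have "(\<lambda>u. if u \<in> W then \<Psi> (\<phi> (real k * \<alpha>) (fst u)) else 0) \<in> borel_measurable borel"
      using W_sub by (intro borel_measurable_if_restrict[OF flow_meas W]) (auto simp: borel_prod[symmetric])
    ultimately have meas: "(\<lambda>u. ennreal \<bar>(if u \<in> W then \<Psi> (snd u) else 0)
        - (if u \<in> W then \<Psi> (\<phi> (real k * \<alpha>) (fst u)) else 0)\<bar>) \<in> borel_measurable borel" by measurable
    have "(\<lambda>w. if (fst w, fst (snd w)) \<in> W
          then ennreal \<bar>\<Psi> (fst (snd w)) - \<Psi> (\<phi> (real k * \<alpha>) (fst w))\<bar> else 0)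
        = (\<lambda>u. ennreal \<bar>(if u \<in> W then \<Psi> (snd u) else 0)
          - (if u \<in> W then \<Psi> (\<phi> (real k * \<alpha>) (fst u)) else 0)\<bar>)
          \<circ> (\<lambda>w :: (real ^ 'd) \<times> (real ^ 'd) \<times> real. (fst w, fst (snd w)))" by auto
    then show "(\<lambda>w :: (real ^ 'd) \<times> (real ^ 'd) \<times> real. if (fst w, fst (snd w)) \<in> W
        then ennreal \<bar>\<Psi> (fst (snd w)) - \<Psi> (\<phi> (real k * \<alpha>) (fst w))\<bar> else 0) \<in> borel_measurable borel"
      using measurable_comp[OF projections(4) meas] by simp
    show "(\<lambda>\<omega>. ennreal \<bar>\<Psi> (X (n + k) \<omega>) - \<Psi> (\<phi> (real k * \<alpha>) (X n \<omega>))\<bar>) \<in> borel_measurable M"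
      using measurable_comp[OF X_\<Theta> Psi_meas, of "n + k"] measurable_comp[OF X_\<Theta> flow_meas, of n]
      unfolding comp_def by measurable
    show "AE \<omega> in M. X n \<omega> \<in> V \<longrightarrow> ennreal \<bar>\<Psi> (X (n + k) \<omega>) - \<Psi> (\<phi> (real k * \<alpha>) (X n \<omega>))\<bar>
      = (if (fst (path_state l n k \<omega>), fst (snd (path_state l n k \<omega>))) \<in> W
         then ennreal \<bar>\<Psi> (fst (snd (path_state l n k \<omega>))) - \<Psi> (\<phi> (real k * \<alpha>) (fst (path_state l n k \<omega>)))\<bar>
         else 0)"
      using in_W by eventually_elim (use V_sub k in \<open>auto simp: path_state_def\<close>)
  qed
  have "AE \<omega> in M. \<forall>k\<in>{..N}. X n \<omega> \<in> V \<longrightarrow> (AE w in ?law k \<omega>. fst (snd w) \<in> S N (X n \<omega>))"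
    using chain_stay by (subst AE_finite_all) auto
  moreover have "AE \<omega> in M. \<forall>k\<in>{..N}. X n \<omega> \<in> V \<longrightarrow>
      nn_cond_exp M (past n) (\<lambda>\<omega>. ennreal \<bar>\<Psi> (X (n + k) \<omega>) - \<Psi> (\<phi> (real k * \<alpha>) (X n \<omega>))\<bar>) \<omega>
      = (\<integral>\<^sup>+w. (if (fst w, fst (snd w)) \<in> W
          then ennreal \<bar>\<Psi> (fst (snd w)) - \<Psi> (\<phi> (real k * \<alpha>) (fst w))\<bar> else 0) \<partial>?law k \<omega>)"
    using chain_error by (subst AE_finite_all) auto
  ultimately show "AE \<omega> in M. X n \<omega> \<in> U \<longrightarrow>
      (SUP k \<in> {0..N}. nn_cond_exp M (natural_filtration M X n)
        (\<lambda>\<omega>'. ennreal \<bar>\<Psi> (X (n + k) \<omega>') - \<Psi> (\<phi> (real k * \<alpha>) (X n \<omega>'))\<bar>) \<omega>)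
      \<le> ennreal ((C1 \<Delta>\<^sub>L' \<alpha> N (R N (X n \<omega>)) (\<lambda>t. \<phi> t (X n \<omega>))
                  + C2 (K\<^sub>1 N) (K\<^sub>2 N) \<alpha> N (R N (X n \<omega>)) (X n \<omega>)) * ?\<Delta>)"
    using chain_weight in_V
  proof eventually_elim
    case (elim \<omega>)
    show ?case
    proof (intro impI SUP_least)
      fix k assume "X n \<omega> \<in> U" and k: "k \<in> {0..N}"
      define \<theta>\<^sub>0 where "\<theta>\<^sub>0 = X n \<omega>"
      have \<theta>\<^sub>0: "\<theta>\<^sub>0 \<in> V" "\<theta>\<^sub>0 \<in> U" using \<open>X n \<omega> \<in> U\<close> elim by (auto simp: \<theta>\<^sub>0_def)
      interpret chain: chain_near_flow K \<alpha> l N \<theta>\<^sub>0 "S N \<theta>\<^sub>0" "T N \<theta>\<^sub>0" "\<lambda>t. \<phi> t \<theta>\<^sub>0" "Q N \<theta>\<^sub>0" "R N \<theta>\<^sub>0"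
        "\<Delta>\<^sub>L' \<alpha> (real N * \<alpha>)" "K\<^sub>1 N" "K\<^sub>2 N"
      proof
        show "0 < \<alpha>" by (rule step_size_pos)
        show "0 \<le> l u" for u by (rule l_nonneg)
        show "pos_def_sym (Q N \<theta>\<^sub>0)" using P1_Q N \<theta>\<^sub>0 by simp
        show "flow_solution (mean_field K) (T N \<theta>\<^sub>0) \<theta>\<^sub>0 (real N * \<alpha>) (\<lambda>t. \<phi> t \<theta>\<^sub>0)"
          using flow[OF N \<theta>\<^sub>0(2)] T_stay[OF N \<theta>\<^sub>0(2)] unfolding flow_solution_def F_def by blast
        show "AE w in chain_law K \<alpha> l k (\<theta>\<^sub>0, \<theta>\<^sub>0, 1). fst (snd w) \<in> S N \<theta>\<^sub>0" if "k \<le> N" for k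
          using elim(1) \<theta>\<^sub>0 that unfolding \<theta>\<^sub>0_def by simp
        show "integrable (K \<theta>) (\<lambda>x. x)" if "\<theta> \<in> S N \<theta>\<^sub>0 \<union> T N \<theta>\<^sub>0" for \<theta>
          using that S_sub[OF N \<theta>\<^sub>0(2)] T_sub[OF N \<theta>\<^sub>0(2)] by (intro mean_field_exists) auto
        show "qnorm (Q N \<theta>\<^sub>0) (mean_field K \<theta> - mean_field K \<theta>') \<le> l (\<theta>\<^sub>0, \<theta>) * qnorm (Q N \<theta>\<^sub>0) (\<theta> - \<theta>')"
          if "\<theta> \<in> S N \<theta>\<^sub>0" "\<theta>' \<in> T N \<theta>\<^sub>0" for \<theta> \<theta>'
          using P2_Lipschitz[OF N \<theta>\<^sub>0(2) that] that \<theta>\<^sub>0 by (simp add: l_eq F_def)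
        show "0 \<le> \<Delta>\<^sub>L' \<alpha> (real N * \<alpha>)" by (rule P3_nonneg[OF N])
        show "qnorm (Q N \<theta>\<^sub>0) (mean_field K \<theta> - mean_field K \<theta>')
            \<le> \<Delta>\<^sub>L' \<alpha> (real N * \<alpha>) * qnorm (Q N \<theta>\<^sub>0) (\<theta> - \<theta>')"
          if "\<theta> \<in> T N \<theta>\<^sub>0" "\<theta>' \<in> T N \<theta>\<^sub>0" for \<theta> \<theta>'
          using P3_Lipschitz[OF N \<theta>\<^sub>0(2) that] by (simp add: F_def)
        show "0 \<le> K\<^sub>1 N" "0 \<le> K\<^sub>2 N" using P4_nonneg[OF N] by auto
        show "0 \<le> R N \<theta>\<^sub>0 \<theta>"
          and "(\<integral>\<^sup>+x. ennreal ((qnorm (Q N \<theta>\<^sub>0) x)\<^sup>2) \<partial>K \<theta>) \<le> ennreal ((R N \<theta>\<^sub>0 \<theta>)\<^sup>2)"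
          if "\<theta> \<in> S N \<theta>\<^sub>0 \<union> T N \<theta>\<^sub>0" for \<theta>
          using P4_moment[OF N \<theta>\<^sub>0(2) that] by (auto simp: esqrt_le_iff)
        show "(R N \<theta>\<^sub>0 \<theta>)\<^sup>2 \<le> (K\<^sub>1 N)\<^sup>2 * (qnorm (Q N \<theta>\<^sub>0) (\<theta> - \<theta>'))\<^sup>2 + (K\<^sub>2 N)\<^sup>2 * (R N \<theta>\<^sub>0 \<theta>')\<^sup>2"
          if "\<theta> \<in> S N \<theta>\<^sub>0 \<union> T N \<theta>\<^sub>0" "\<theta>' \<in> S N \<theta>\<^sub>0 \<union> T N \<theta>\<^sub>0" for \<theta> \<theta>'
          by (rule P4_growth[OF N \<theta>\<^sub>0(2) that])
        show "(\<lambda>t. R N \<theta>\<^sub>0 (\<phi> t \<theta>\<^sub>0)) \<in> borel_measurable (lebesgue_on {0..real N * \<alpha>})"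
          by (rule R_meas[OF N \<theta>\<^sub>0(2)])
      qed
      have "nn_cond_exp M (past n) (\<lambda>\<omega>. ennreal \<bar>\<Psi> (X (n + k) \<omega>) - \<Psi> (\<phi> (real k * \<alpha>) (X n \<omega>))\<bar>) \<omega>
        = (\<integral>\<^sup>+w. (if (fst w, fst (snd w)) \<in> W
          then ennreal \<bar>\<Psi> (fst (snd w)) - \<Psi> (\<phi> (real k * \<alpha>) (fst w))\<bar> else 0) \<partial>chain.law k)"
        using elim(2) k \<theta>\<^sub>0 by (simp add: \<theta>\<^sub>0_def)
      also have "\<dots> \<le> (\<integral>\<^sup>+w. ennreal (qnorm (Q N \<theta>\<^sub>0) (fst (snd w) - \<phi> (real k * \<alpha>) \<theta>\<^sub>0)) \<partial>chain.law k)"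
      proof (rule nn_integral_mono_AE)
        have "AE w in chain.law k. fst w = \<theta>\<^sub>0"
          using AE_chain_law_fst[of "(\<theta>\<^sub>0, \<theta>\<^sub>0, 1)" k] by simp
        moreover have "AE w in chain.law k. fst (snd w) \<in> S N \<theta>\<^sub>0" using k by (intro chain.stay) simp
        ultimately show "AE w in chain.law k. (if (fst w, fst (snd w)) \<in> W
            then ennreal \<bar>\<Psi> (fst (snd w)) - \<Psi> (\<phi> (real k * \<alpha>) (fst w))\<bar> else 0)
          \<le> ennreal (qnorm (Q N \<theta>\<^sub>0) (fst (snd w) - \<phi> (real k * \<alpha>) \<theta>\<^sub>0))"
        proof eventually_elim
          case (elim w)
          have "\<phi> (real k * \<alpha>) \<theta>\<^sub>0 \<in> T N \<theta>\<^sub>0"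
            using k step_size_pos by (intro chain.flow_in_T) (auto intro: mult_right_mono)
          then have "\<bar>\<Psi> (fst (snd w)) - \<Psi> (\<phi> (real k * \<alpha>) \<theta>\<^sub>0)\<bar>
              \<le> qnorm (Q N \<theta>\<^sub>0) (fst (snd w) - \<phi> (real k * \<alpha>) \<theta>\<^sub>0)"
            using elim P1[OF N \<theta>\<^sub>0(2)]
            by (intro qnorm_Lipschitz_of_derivative_bound[where C = "convex hull (S N \<theta>\<^sub>0 \<union> T N \<theta>\<^sub>0)"]
                P1_Q N \<theta>\<^sub>0 convex_convex_hull) (auto intro: hull_inc)
          then show ?case using elim by (simp add: ennreal_leI)
        qed
      qed
      also have "\<dots> \<le> ennreal ((C1 (\<lambda>_ _. \<Delta>\<^sub>L' \<alpha> (real N * \<alpha>)) \<alpha> N (R N \<theta>\<^sub>0) (\<lambda>t. \<phi> t \<theta>\<^sub>0)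
          + C2 (K\<^sub>1 N) (K\<^sub>2 N) \<alpha> N (R N \<theta>\<^sub>0) \<theta>\<^sub>0) * ?\<Delta>)"
        using elim(3) \<theta>\<^sub>0 k by (intro chain.mean_error_le) (auto simp: \<theta>\<^sub>0_def)
      finally show "nn_cond_exp M (past n)
          (\<lambda>\<omega>'. ennreal \<bar>\<Psi> (X (n + k) \<omega>') - \<Psi> (\<phi> (real k * \<alpha>) (X n \<omega>'))\<bar>) \<omega>
        \<le> ennreal ((C1 \<Delta>\<^sub>L' \<alpha> N (R N (X n \<omega>)) (\<lambda>t. \<phi> t (X n \<omega>))
                  + C2 (K\<^sub>1 N) (K\<^sub>2 N) \<alpha> N (R N (X n \<omega>)) (X n \<omega>)) * ?\<Delta>)"
        by (simp add: \<theta>\<^sub>0_def C1_def)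
    qed
  qed
qed

end
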